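(* Let $\mu,\nu\in\mathcal{P}_2(\mathbf{R}^d)$ and let $\nu'$ be a translate of $\nu$, i.e. $\nu'=\tau_\sharp\nu$ with $\tau(x)=x+h$ for some $h\in\mathbf{R}^d$. Then $$W_2^2(\mu,\nu)-W_2^2\big(\mathrm{P}^2_{\mathbf{R}^d}[\mu],\mathrm{P}^2_{\mathbf{R}^d}[\nu]\big)=W_2^2(\mu,\nu')-W_2^2\big(\mathrm{P}^2_{\mathbf{R}^d}[\mu],\mathrm{P}^2_{\mathbf{R}^d}[\nu']\big).$$
   Context: $\mathcal{P}_2(\mathbf{R}^d)$ is the set of Borel probability measures on $\mathbf{R}^d$ with finite second moment and $W_2$ is the $2$-Wasserstein distance. Let $\mathcal{K}_2(\mathbf{R}^d)$ be the set of $\rho\in\mathcal{P}_2(\mathbf{R}^d)$ that are absolutely continuous with respect to Lebesgue measure with density satisfying $0\le\rho\le1$ a.e. $\mathrm{P}^2_{\mathbf{R}^d}[\mu]$ denotes the metric projection of $\mu$ onto $\mathcal{K}_2(\mathbf{R}^d)$, i.e. the minimizer of $\rho\mapsto W_2^2(\rho,\mu)$ over $\rho\in\mathcal{K}_2(\mathbf{R}^d)$, which is known to exist and be unique. *)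

theory Defs
  imports "HOL-Probability.Probability"
begin

definition P2 :: "'a::euclidean_space measure set" where
  "P2 = {\<mu>. prob_space \<mu> \<and> sets \<mu> = sets borel \<and> integrable \<mu> (\<lambda>x. (norm x)\<^sup>2)}"

definition couplings ::
  "'a::euclidean_space measure \<Rightarrow> 'a measure \<Rightarrow> ('a \<times> 'a) measure set" where
  "couplings \<mu> \<nu> = {\<gamma>. prob_space \<gamma> \<and> sets \<gamma> = sets (borel \<Otimes>\<^sub>M borel) \<and>
     distr \<gamma> borel fst = \<mu> \<and> distr \<gamma> borel snd = \<nu>}"

text \<open>The infimum is taken in the extended nonnegative reals. It is finite for measures in
  \<open>P2\<close>, so the conversion to a real number loses nothing there.\<close>

definition W2 :: "'a::euclidean_space measure \<Rightarrow> 'a measure \<Rightarrow> real" where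
  "W2 \<mu> \<nu> = sqrt (enn2real
     (INF \<gamma>\<in>couplings \<mu> \<nu>. \<integral>\<^sup>+ p. ennreal ((dist (fst p) (snd p))\<^sup>2) \<partial>\<gamma>))"

definition K2 :: "'a::euclidean_space measure set" where
  "K2 = {\<rho> \<in> P2. \<exists>f::'a \<Rightarrow> real. f \<in> borel_measurable borel \<and>
     (AE x in lborel. 0 \<le> f x \<and> f x \<le> 1) \<and> \<rho> = density lborel (\<lambda>x. ennreal (f x))}"

definition proj_K2 :: "'a::euclidean_space measure \<Rightarrow> 'a measure" where
  "proj_K2 \<mu> = (THE \<rho>. is_arg_min (\<lambda>\<rho>. (W2 \<rho> \<mu>)\<^sup>2) (\<lambda>\<rho>. \<rho> \<in> K2) \<rho>)"

end

theory Submission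
  imports Defs
begin

text \<open>
  Shifting the two marginals by \<open>a\<close> and \<open>b\<close> changes the squared Wasserstein distance by
  \<open>|a - b|\<^sup>2\<close> plus twice the inner product of \<open>a - b\<close> with the difference of the barycenters.
  The projection onto \<open>K2\<close> commutes with translations and, by its optimality among its own
  translates, preserves barycenters; hence both squared distances in the claim change by the same amount
  when \<open>\<nu>\<close> is translated.

  This presupposes that the minimizer exists and is unique. Existence: near-minimizing densities can be
  chosen to converge almost everywhere, since the set of densities with nearly minimal cost is closed
  under midpoints, and the cost is lower semicontinuous under such convergence. Uniqueness: if
  \<open>f\<^sub>0\<close> and \<open>f\<^sub>1\<close> are optimal, so is their mean \<open>m\<close>. Where \<open>f\<^sub>0 < f\<^sub>1\<close>
  the constraint is slack for \<open>f\<^sub>0\<close> and \<open>m\<close>, so optimal mass does not move there, which gives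
  \<open>m \<le> \<mu>\<close> and then \<open>m \<le> f\<^sub>0\<close> on this set, a contradiction. Optimal plans are never used, only
  plans of nearly optimal cost.
\<close>

section \<open>Couplings and transport cost\<close>

text \<open>Existence of optimal plans would call for weak compactness of couplings. Every argument
  here is quantitative instead: rerouting mass saves a definite amount per unit, so a plan whose
  cost exceeds the optimum by at most \<eta> leaves only little mass that could profitably be
  rerouted, and \<eta> is sent to 0. The price is that "mass does not move" is reached only as a
  limit: the mass of a compact set is compared with that of its closed thickenings up to an error,
  and then both the error and the thickness tend to 0. This is why the slackness estimates concern
  compact sets, with inner regularity leading to them and back. The midpoint \<open>m\<close> enters
  because two constraints must be slack by a definite amount on one set: where
  \<open>f0 + 2 * d \<le> f1\<close>, the bound \<open>f1 \<le> 1\<close> leaves room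
  \<open>d\<close> above \<open>m\<close>, which bounds \<mu> from below, and room above
  \<open>f0\<close>, which lets that part of \<mu> be served in place.\<close>

text \<open>Modified plans are glued from a kept part and a rerouted part; this is the sum that
  glues them. The sigma-algebra is read off the first summand, so the facts below ask the second to
  carry the same one.\<close>

definition add_measure :: "'a measure \<Rightarrow> 'a measure \<Rightarrow> 'a measure" where
  "add_measure M N = measure_of (space M) (sets M) (\<lambda>A. emeasure M A + emeasure N A)"

lemma sets_add_measure [simp, measurable_cong]: "sets (add_measure M N) = sets M"
  by (simp add: add_measure_def)

lemma space_add_measure [simp]: "space (add_measure M N) = space M"
  by (simp add: add_measure_def)

lemma emeasure_add_measure:
  assumes "sets N = sets M" "A \<in> sets M"
  shows "emeasure (add_measure M N) A = emeasure M A + emeasure N A"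
  unfolding add_measure_def
proof (rule emeasure_measure_of_sigma)
  show "countably_additive (sets M) (\<lambda>A. emeasure M A + emeasure N A)"
    by (rule countably_additiveI) (use assms(1) in \<open>simp add: suminf_add[symmetric] suminf_emeasure\<close>)
qed (use assms in \<open>auto simp: positive_def sets.sigma_algebra_axioms\<close>)

lemma nn_integral_add_measure:
  assumes [measurable_cong]: "sets N = sets M" and "f \<in> borel_measurable M"
  shows "(\<integral>\<^sup>+x. f x \<partial>add_measure M N) = (\<integral>\<^sup>+x. f x \<partial>M) + (\<integral>\<^sup>+x. f x \<partial>N)"
  using assms(2)
proof induction
  case (cong f g)
  then show ?case
    using sets_eq_imp_space_eq[OF assms(1)] by (simp cong: nn_integral_cong_simp)
next
  case (set A)
  then show ?case by (simp add: emeasure_add_measure assms)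
next
  case (mult u c)
  then show ?case by (simp add: nn_integral_cmult distrib_left)
next
  case (add u v)
  then show ?case by (simp add: nn_integral_add algebra_simps)
next
  case (seq U)
  have inc: "incseq (\<lambda>i. integral\<^sup>N K (U i))" for K
    using \<open>incseq U\<close> by (auto simp: incseq_def le_fun_def intro!: nn_integral_mono)
  show ?case
    using seq by (simp add: nn_integral_monotone_convergence_SUP image_comp inc ennreal_SUP_add)
qed

definition tcost :: "('a::euclidean_space \<times> 'a) measure \<Rightarrow> ennreal" where
  "tcost \<gamma> = (\<integral>\<^sup>+ p. ennreal ((dist (fst p) (snd p))\<^sup>2) \<partial>\<gamma>)"

text \<open>The squared distance before conversion to a real number. In \<open>ennreal\<close>
  infima and integrals are always defined, and finiteness matters mainly where a summand is
  cancelled; \<open>W2_sq\<close> leads back to the reals.\<close>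

definition OT :: "'a::euclidean_space measure \<Rightarrow> 'a measure \<Rightarrow> ennreal" where
  "OT \<mu> \<nu> = (INF \<gamma>\<in>couplings \<mu> \<nu>. tcost \<gamma>)"

lemma W2_sq: "(W2 \<mu> \<nu>)\<^sup>2 = enn2real (OT \<mu> \<nu>)"
  by (simp add: W2_def OT_def tcost_def)

lemma P2D:
  assumes "\<mu> \<in> P2"
  shows "prob_space \<mu>" "sets \<mu> = sets borel" "integrable \<mu> (\<lambda>x. (norm x)\<^sup>2)"
    "space \<mu> = UNIV" "emeasure \<mu> UNIV = 1"
proof -
  show *: "prob_space \<mu>" "sets \<mu> = sets borel" "integrable \<mu> (\<lambda>x. (norm x)\<^sup>2)"
    using assms by (auto simp: P2_def)
  show **: "space \<mu> = UNIV" using sets_eq_imp_space_eq[OF *(2)] by simp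
  show "emeasure \<mu> UNIV = 1" using prob_space.emeasure_space_1[OF *(1)] ** by simp
qed

lemma P2I:
  assumes "sets \<mu> = sets borel" "emeasure \<mu> UNIV = 1" "(\<integral>\<^sup>+x. ennreal ((norm x)\<^sup>2) \<partial>\<mu>) < \<infinity>"
  shows "\<mu> \<in> P2"
proof -
  note assms(1)[measurable_cong]
  have "integrable \<mu> (\<lambda>x. (norm x)\<^sup>2)"
    using assms(3) by (intro integrableI_nonneg) auto
  then show ?thesis
    using assms sets_eq_imp_space_eq[OF assms(1)] by (auto simp: P2_def intro!: prob_spaceI)
qed

lemma P2_second_moment_finite:
  assumes "\<mu> \<in> P2"
  shows "(\<integral>\<^sup>+x. ennreal ((norm x)\<^sup>2) \<partial>\<mu>) < \<infinity>"
  using P2D(3)[OF assms] by (simp add: integrable_iff_bounded)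

lemma couplingsD:
  assumes "\<gamma> \<in> couplings \<mu> \<nu>"
  shows "prob_space \<gamma>" "sets \<gamma> = sets (borel \<Otimes>\<^sub>M borel)" "space \<gamma> = UNIV"
    "distr \<gamma> borel fst = \<mu>" "distr \<gamma> borel snd = \<nu>"
proof -
  show "prob_space \<gamma>" "sets \<gamma> = sets (borel \<Otimes>\<^sub>M borel)" "distr \<gamma> borel fst = \<mu>" "distr \<gamma> borel snd = \<nu>"
    using assms by (auto simp: couplings_def)
  then show "space \<gamma> = UNIV"
    using sets_eq_imp_space_eq by (fastforce simp: space_pair_measure)
qed

lemma coupling_fst:
  assumes "\<gamma> \<in> couplings \<mu> \<nu>" and [measurable]: "f \<in> borel_measurable borel"
  shows "(\<integral>\<^sup>+p. f (fst p) \<partial>\<gamma>) = (\<integral>\<^sup>+x. f x \<partial>\<mu>)"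
proof -
  note couplingsD(2)[OF assms(1), measurable_cong]
  show ?thesis
    unfolding couplingsD(4)[OF assms(1), symmetric] by (subst nn_integral_distr) auto
qed

lemma coupling_snd:
  assumes "\<gamma> \<in> couplings \<mu> \<nu>" and [measurable]: "f \<in> borel_measurable borel"
  shows "(\<integral>\<^sup>+p. f (snd p) \<partial>\<gamma>) = (\<integral>\<^sup>+x. f x \<partial>\<nu>)"
proof -
  note couplingsD(2)[OF assms(1), measurable_cong]
  show ?thesis
    unfolding couplingsD(5)[OF assms(1), symmetric] by (subst nn_integral_distr) auto
qed

text \<open>The marginals are tested through integrals of indicators because the glued plans are
  known by a formula for their integrals.\<close>

lemma couplingsI:
  assumes s: "sets \<gamma> = sets (borel \<Otimes>\<^sub>M borel)"
    and m: "sets \<mu> = sets borel" "sets \<nu> = sets borel" "emeasure \<mu> UNIV = 1"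
    and f: "\<And>E. E \<in> sets borel \<Longrightarrow> (\<integral>\<^sup>+p. indicator E (fst p) \<partial>\<gamma>) = emeasure \<mu> E"
    and g: "\<And>E. E \<in> sets borel \<Longrightarrow> (\<integral>\<^sup>+p. indicator E (snd p) \<partial>\<gamma>) = emeasure \<nu> E"
  shows "\<gamma> \<in> couplings \<mu> \<nu>"
proof -
  note s[measurable_cong]
  have "emeasure \<gamma> (space \<gamma>) = 1" using f[of UNIV] m by simp
  moreover have "distr \<gamma> borel fst = \<mu>"
  proof (rule measure_eqI)
    fix E :: "'a set" assume "E \<in> sets (distr \<gamma> borel fst)"
    then have [measurable]: "E \<in> sets borel" by simp
    have "emeasure (distr \<gamma> borel fst) E = (\<integral>\<^sup>+x. indicator E x \<partial>distr \<gamma> borel fst)" by simp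
    also have "\<dots> = emeasure \<mu> E" by (subst nn_integral_distr) (simp_all add: f del: nn_integral_indicator)
    finally show "emeasure (distr \<gamma> borel fst) E = emeasure \<mu> E" .
  qed (use m in auto)
  moreover have "distr \<gamma> borel snd = \<nu>"
  proof (rule measure_eqI)
    fix E :: "'a set" assume "E \<in> sets (distr \<gamma> borel snd)"
    then have [measurable]: "E \<in> sets borel" by simp
    have "emeasure (distr \<gamma> borel snd) E = (\<integral>\<^sup>+x. indicator E x \<partial>distr \<gamma> borel snd)" by simp
    also have "\<dots> = emeasure \<nu> E" by (subst nn_integral_distr) (simp_all add: g del: nn_integral_indicator)
    finally show "emeasure (distr \<gamma> borel snd) E = emeasure \<nu> E" .
  qed (use m in auto)
  ultimately show ?thesis
    using s by (auto simp: couplings_def intro: prob_spaceI)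
qed

lemma norm_sq_le: "(norm (x - y))\<^sup>2 \<le> 2 * (norm x)\<^sup>2 + 2 * (norm (y::'a::real_normed_vector))\<^sup>2"
proof -
  have "(norm (x - y))\<^sup>2 \<le> (norm x + norm y)\<^sup>2"
    by (intro power_mono norm_triangle_ineq4) auto
  also have "\<dots> \<le> 2 * (norm x)\<^sup>2 + 2 * (norm y)\<^sup>2"
    using sum_squares_ge_zero[of "norm x - norm y" 0] by (simp add: power2_eq_square algebra_simps)
  finally show ?thesis .
qed

lemma pair_measure_in_couplings:
  assumes "\<mu> \<in> P2" "\<nu> \<in> P2"
  shows "\<mu> \<Otimes>\<^sub>M \<nu> \<in> couplings \<mu> \<nu>"
proof -
  note P2D(2)[OF assms(1), measurable_cong] P2D(2)[OF assms(2), measurable_cong]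
  interpret M: prob_space \<mu> by (rule P2D[OF assms(1)])
  interpret N: prob_space \<nu> by (rule P2D[OF assms(2)])
  interpret MN: pair_prob_space \<mu> \<nu> ..
  show ?thesis
  proof (rule couplingsI)
    fix E :: "'a set" assume [measurable]: "E \<in> sets borel"
    show "(\<integral>\<^sup>+p. indicator E (fst p) \<partial>(\<mu> \<Otimes>\<^sub>M \<nu>)) = emeasure \<mu> E"
      by (subst N.nn_integral_fst[symmetric]) (auto simp: N.emeasure_space_1 P2D[OF assms(1)])
    show "(\<integral>\<^sup>+p. indicator E (snd p) \<partial>(\<mu> \<Otimes>\<^sub>M \<nu>)) = emeasure \<nu> E"
      by (subst N.nn_integral_fst[symmetric]) (auto simp: M.emeasure_space_1 P2D[OF assms(2)])
  qed (use assms in \<open>auto simp: P2D cong: sets_pair_measure_cong\<close>)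
qed

text \<open>Integrates \<open>norm_sq_le\<close>. Stated for measures of any mass on the product, so
  that it also covers plans between the remainders of two measures.\<close>

lemma tcost_le_moments:
  assumes [measurable_cong]: "sets \<gamma> = sets (borel \<Otimes>\<^sub>M borel)"
  shows "tcost \<gamma> \<le> 2 * (\<integral>\<^sup>+p. ennreal ((norm (fst p))\<^sup>2) \<partial>\<gamma>) + 2 * (\<integral>\<^sup>+p. ennreal ((norm (snd p))\<^sup>2) \<partial>\<gamma>)"
proof -
  have "tcost \<gamma> \<le> (\<integral>\<^sup>+p. 2 * ennreal ((norm (fst p))\<^sup>2) + 2 * ennreal ((norm (snd p))\<^sup>2) \<partial>\<gamma>)"
    unfolding tcost_def
  proof (rule nn_integral_mono)
    fix p :: "'a \<times> 'a"
    have "ennreal ((dist (fst p) (snd p))\<^sup>2) \<le> ennreal (2 * (norm (fst p))\<^sup>2 + 2 * (norm (snd p))\<^sup>2)"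
      by (intro ennreal_leI) (simp add: dist_norm norm_sq_le)
    then show "ennreal ((dist (fst p) (snd p))\<^sup>2) \<le> 2 * ennreal ((norm (fst p))\<^sup>2) + 2 * ennreal ((norm (snd p))\<^sup>2)"
      by (simp add: ennreal_mult)
  qed
  also have "\<dots> = 2 * (\<integral>\<^sup>+p. ennreal ((norm (fst p))\<^sup>2) \<partial>\<gamma>) + 2 * (\<integral>\<^sup>+p. ennreal ((norm (snd p))\<^sup>2) \<partial>\<gamma>)"
    by (simp add: nn_integral_add nn_integral_cmult)
  finally show ?thesis .
qed

lemma tcost_le:
  assumes g: "\<gamma> \<in> couplings \<mu> \<nu>"
  shows "tcost \<gamma> \<le> 2 * (\<integral>\<^sup>+x. ennreal ((norm x)\<^sup>2) \<partial>\<mu>) + 2 * (\<integral>\<^sup>+x. ennreal ((norm x)\<^sup>2) \<partial>\<nu>)"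
  using tcost_le_moments[OF couplingsD(2)[OF g]] coupling_fst[OF g, of "\<lambda>x. ennreal ((norm x)\<^sup>2)"]
    coupling_snd[OF g, of "\<lambda>x. ennreal ((norm x)\<^sup>2)"] by simp

lemma OT_finite:
  assumes "\<mu> \<in> P2" "\<nu> \<in> P2"
  shows "OT \<mu> \<nu> < \<infinity>"
proof -
  have "OT \<mu> \<nu> \<le> tcost (\<mu> \<Otimes>\<^sub>M \<nu>)"
    unfolding OT_def by (rule INF_lower) (rule pair_measure_in_couplings[OF assms])
  also have "\<dots> \<le> 2 * (\<integral>\<^sup>+x. ennreal ((norm x)\<^sup>2) \<partial>\<mu>) + 2 * (\<integral>\<^sup>+x. ennreal ((norm x)\<^sup>2) \<partial>\<nu>)"
    by (rule tcost_le) (rule pair_measure_in_couplings[OF assms])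
  also have "\<dots> < \<infinity>"
    using P2_second_moment_finite assms by (auto simp: ennreal_mult_less_top)
  finally show ?thesis .
qed

text \<open>A plan of finite cost carries a finite second moment from the target back to the source.
  This puts the first marginals of modified plans into \<open>P2\<close> and bounds the moments of
  near-minimizers uniformly.\<close>

lemma coupling_fst_moment:
  assumes g: "\<gamma> \<in> couplings \<mu> \<nu>"
  shows "(\<integral>\<^sup>+x. ennreal ((norm x)\<^sup>2) \<partial>\<mu>) \<le> 2 * tcost \<gamma> + 2 * (\<integral>\<^sup>+x. ennreal ((norm x)\<^sup>2) \<partial>\<nu>)"
proof -
  note couplingsD(2)[OF g, measurable_cong]
  have "(\<integral>\<^sup>+x. ennreal ((norm x)\<^sup>2) \<partial>\<mu>) = (\<integral>\<^sup>+p. ennreal ((norm (fst p))\<^sup>2) \<partial>\<gamma>)"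
    using coupling_fst[OF g, of "\<lambda>x. ennreal ((norm x)\<^sup>2)"] by simp
  also have "\<dots> \<le> (\<integral>\<^sup>+p. 2 * ennreal ((dist (fst p) (snd p))\<^sup>2) + 2 * ennreal ((norm (snd p))\<^sup>2) \<partial>\<gamma>)"
  proof (rule nn_integral_mono)
    fix p :: "'a \<times> 'a"
    have "ennreal ((norm (fst p))\<^sup>2) \<le> ennreal (2 * (dist (fst p) (snd p))\<^sup>2 + 2 * (norm (snd p))\<^sup>2)"
      using norm_sq_le[of "fst p - snd p" "- snd p"] by (intro ennreal_leI) (simp add: dist_norm)
    then show "ennreal ((norm (fst p))\<^sup>2) \<le> 2 * ennreal ((dist (fst p) (snd p))\<^sup>2) + 2 * ennreal ((norm (snd p))\<^sup>2)"
      by (simp add: ennreal_mult)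
  qed
  also have "\<dots> = 2 * tcost \<gamma> + 2 * (\<integral>\<^sup>+p. ennreal ((norm (snd p))\<^sup>2) \<partial>\<gamma>)"
    by (simp add: nn_integral_add nn_integral_cmult tcost_def)
  also have "\<dots> = 2 * tcost \<gamma> + 2 * (\<integral>\<^sup>+x. ennreal ((norm x)\<^sup>2) \<partial>\<nu>)"
    using coupling_snd[OF g, of "\<lambda>x. ennreal ((norm x)\<^sup>2)"] by simp
  finally show ?thesis .
qed

lemma OT_le_tcost: "\<gamma> \<in> couplings \<mu> \<nu> \<Longrightarrow> OT \<mu> \<nu> \<le> tcost \<gamma>"
  unfolding OT_def by (rule INF_lower)

lemma OT_near_optimal:
  assumes "OT \<mu> \<nu> < c"
  obtains \<gamma> where "\<gamma> \<in> couplings \<mu> \<nu>" "tcost \<gamma> < c"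
  using assms unfolding OT_def by (auto simp: INF_less_iff)

section \<open>Translations and barycenters\<close>

definition translate :: "'a::euclidean_space \<Rightarrow> 'a measure \<Rightarrow> 'a measure" where
  "translate a \<mu> = distr \<mu> borel (\<lambda>x. x + a)"

definition barycenter :: "'a::euclidean_space measure \<Rightarrow> 'a" where
  "barycenter \<mu> = (\<integral>x. x \<partial>\<mu>)"

lemma P2_integrable_id:
  assumes "\<mu> \<in> P2"
  shows "integrable \<mu> (\<lambda>x. x)"
proof -
  note P2D(2)[OF assms, measurable_cong]
  interpret prob_space \<mu> by (rule P2D[OF assms])
  have bound: "norm x \<le> norm (1 + (norm x)\<^sup>2)" for x :: 'a
    using sum_squares_ge_zero[of "norm x - 1/2" 0]
    by (simp add: power2_eq_square algebra_simps)
  have "integrable \<mu> (\<lambda>x. 1 + (norm x)\<^sup>2)"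
    using P2D(3)[OF assms] by simp
  then show ?thesis
    by (rule Bochner_Integration.integrable_bound) (simp_all add: bound del: real_norm_def)
qed

lemma sets_translate [simp]: "sets (translate a \<mu>) = sets borel"
  by (simp add: translate_def)

lemma emeasure_translate:
  assumes [measurable_cong]: "sets \<mu> = sets borel" and [measurable]: "E \<in> sets borel"
  shows "emeasure (translate a \<mu>) E = emeasure \<mu> {x. x + a \<in> E}"
  unfolding translate_def using sets_eq_imp_space_eq[OF assms(1)]
  by (subst emeasure_distr) (auto simp: vimage_def)

lemma P2_translate:
  assumes "\<mu> \<in> P2"
  shows "translate a \<mu> \<in> P2"
proof -
  note P2D(2)[OF assms, measurable_cong]
  interpret prob_space \<mu> by (rule P2D[OF assms])
  have "integrable \<mu> (\<lambda>x. (norm (x + a))\<^sup>2)"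
  proof (rule Bochner_Integration.integrable_bound)
    show "integrable \<mu> (\<lambda>x. 2 * (norm x)\<^sup>2 + 2 * (norm a)\<^sup>2)"
      using P2D(3)[OF assms] by simp
    show "AE x in \<mu>. norm ((norm (x + a))\<^sup>2) \<le> norm (2 * (norm x)\<^sup>2 + 2 * (norm a)\<^sup>2)"
      using norm_sq_le[of _ "- a"] by (auto simp: abs_of_nonneg)
  qed simp
  then have "integrable (translate a \<mu>) (\<lambda>x. (norm x)\<^sup>2)"
    unfolding translate_def by (subst integrable_distr_eq) auto
  then show ?thesis
    by (auto simp: P2_def translate_def prob_space_distr)
qed

lemma barycenter_translate:
  assumes "\<mu> \<in> P2"
  shows "barycenter (translate a \<mu>) = barycenter \<mu> + a"
proof -
  note P2D(2)[OF assms, measurable_cong]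
  interpret prob_space \<mu> by (rule P2D[OF assms])
  show ?thesis
    unfolding barycenter_def translate_def
    by (subst integral_distr) (auto simp: P2_integrable_id[OF assms] prob_space)
qed

lemma translate_translate:
  assumes "sets \<mu> = sets borel"
  shows "translate a (translate b \<mu>) = translate (a + b) \<mu>"
proof -
  note assms[measurable_cong]
  show ?thesis
    unfolding translate_def by (subst distr_distr) (auto simp: o_def algebra_simps)
qed

lemma translate_0:
  assumes "sets \<mu> = sets borel"
  shows "translate 0 \<mu> = \<mu>"
  unfolding translate_def using assms by (simp add: distr_id2)

lemma coupling_translate:
  assumes g: "\<gamma> \<in> couplings \<mu> \<nu>"
  shows "distr \<gamma> (borel \<Otimes>\<^sub>M borel) (\<lambda>p. (fst p + a, snd p + b)) \<in> couplings (translate a \<mu>) (translate b \<nu>)"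
proof -
  note couplingsD(2)[OF g, measurable_cong]
  interpret prob_space \<gamma> by (rule couplingsD[OF g])
  have "distr (distr \<gamma> (borel \<Otimes>\<^sub>M borel) (\<lambda>p. (fst p + a, snd p + b))) borel fst = translate a \<mu>"
    unfolding couplingsD(4)[OF g, symmetric] translate_def
    by (subst (1 2) distr_distr) (auto simp: o_def)
  moreover have "distr (distr \<gamma> (borel \<Otimes>\<^sub>M borel) (\<lambda>p. (fst p + a, snd p + b))) borel snd = translate b \<nu>"
    unfolding couplingsD(5)[OF g, symmetric] translate_def
    by (subst (1 2) distr_distr) (auto simp: o_def)
  ultimately show ?thesis
    by (auto simp: couplings_def intro!: prob_space_distr)
qed

lemma tcost_finite:
  assumes "\<mu> \<in> P2" "\<nu> \<in> P2" "\<gamma> \<in> couplings \<mu> \<nu>"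
  shows "tcost \<gamma> < \<infinity>"
  using tcost_le[OF assms(3)] P2_second_moment_finite[OF assms(1)] P2_second_moment_finite[OF assms(2)]
  by (auto simp: ennreal_mult_less_top intro: le_less_trans)

lemma coupling_integrable:
  assumes "\<mu> \<in> P2" "\<nu> \<in> P2" "\<gamma> \<in> couplings \<mu> \<nu>"
  shows "integrable \<gamma> fst" "integrable \<gamma> snd" "integrable \<gamma> (\<lambda>p. (dist (fst p) (snd p))\<^sup>2)"
    "integral\<^sup>L \<gamma> fst = barycenter \<mu>" "integral\<^sup>L \<gamma> snd = barycenter \<nu>"
proof -
  note couplingsD(2)[OF assms(3), measurable_cong]
  have m: "(fst :: 'a \<times> 'a \<Rightarrow> 'a) \<in> \<gamma> \<rightarrow>\<^sub>M borel" "(snd :: 'a \<times> 'a \<Rightarrow> 'a) \<in> \<gamma> \<rightarrow>\<^sub>M borel"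
    by measurable
  have "integrable (distr \<gamma> borel fst) (\<lambda>x. x)" "integrable (distr \<gamma> borel snd) (\<lambda>x. x)"
    using assms by (auto simp: couplingsD P2_integrable_id)
  then show "integrable \<gamma> fst" "integrable \<gamma> snd"
    using integrable_distr_eq[OF m(1), of "\<lambda>x::'a. x"] integrable_distr_eq[OF m(2), of "\<lambda>x::'a. x"]
    by (simp_all only: borel_measurable_const measurable_ident_sets)
  have "integral\<^sup>L (distr \<gamma> borel fst) (\<lambda>x. x) = integral\<^sup>L \<gamma> fst"
    by (subst integral_distr) auto
  then show "integral\<^sup>L \<gamma> fst = barycenter \<mu>"
    using assms by (simp add: couplingsD barycenter_def)
  have "integral\<^sup>L (distr \<gamma> borel snd) (\<lambda>x. x) = integral\<^sup>L \<gamma> snd"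
    by (subst integral_distr) auto
  then show "integral\<^sup>L \<gamma> snd = barycenter \<nu>"
    using assms by (simp add: couplingsD barycenter_def)
  show "integrable \<gamma> (\<lambda>p. (dist (fst p) (snd p))\<^sup>2)"
    using tcost_finite[OF assms] by (intro integrableI_nonneg) (auto simp: tcost_def)
qed

lemma tcost_eq_integral:
  assumes "\<mu> \<in> P2" "\<nu> \<in> P2" "\<gamma> \<in> couplings \<mu> \<nu>"
  shows "tcost \<gamma> = ennreal (\<integral>p. (dist (fst p) (snd p))\<^sup>2 \<partial>\<gamma>)"
  unfolding tcost_def using coupling_integrable(3)[OF assms]
  by (intro nn_integral_eq_integral) auto

text \<open>The cross term is linear in the displacement, so it integrates to a quantity that
  depends on the marginals alone. Being the same for every plan, it passes through the
  infimum.\<close>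

lemma tcost_translate:
  assumes "\<mu> \<in> P2" "\<nu> \<in> P2" "\<gamma> \<in> couplings \<mu> \<nu>"
  shows "enn2real (tcost (distr \<gamma> (borel \<Otimes>\<^sub>M borel) (\<lambda>p. (fst p + a, snd p + b)))) =
    enn2real (tcost \<gamma>) + (norm (a - b))\<^sup>2 + 2 * ((a - b) \<bullet> (barycenter \<mu> - barycenter \<nu>))"
proof -
  note couplingsD(2)[OF assms(3), measurable_cong]
  interpret prob_space \<gamma> by (rule couplingsD[OF assms(3)])
  note int = coupling_integrable[OF assms]
  have eq: "(dist (fst p + a) (snd p + b))\<^sup>2 =
      (dist (fst p) (snd p))\<^sup>2 + (norm (a - b))\<^sup>2 + 2 * ((a - b) \<bullet> (fst p - snd p))" for p :: "'a \<times> 'a"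
    by (simp add: dist_norm power2_norm_eq_inner inner_commute algebra_simps)
  have "enn2real (tcost (distr \<gamma> (borel \<Otimes>\<^sub>M borel) (\<lambda>p. (fst p + a, snd p + b)))) =
      (\<integral>p. (dist (fst p) (snd p))\<^sup>2 \<partial>distr \<gamma> (borel \<Otimes>\<^sub>M borel) (\<lambda>p. (fst p + a, snd p + b)))"
    by (subst tcost_eq_integral[OF P2_translate[OF assms(1)] P2_translate[OF assms(2)] coupling_translate[OF assms(3)]]) simp
  also have "\<dots> = (\<integral>p. (dist (fst p + a) (snd p + b))\<^sup>2 \<partial>\<gamma>)"
    by (subst integral_distr) auto
  also have "\<dots> = (\<integral>p. (dist (fst p) (snd p))\<^sup>2 \<partial>\<gamma>) + (norm (a - b))\<^sup>2 +
      2 * ((a - b) \<bullet> (integral\<^sup>L \<gamma> fst - integral\<^sup>L \<gamma> snd))"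
    unfolding eq using int by (simp add: prob_space)
  finally show ?thesis
    using int by (simp add: tcost_eq_integral[OF assms])
qed

lemma OT_near_optimal_add:
  assumes "OT \<mu> \<nu> < \<infinity>" "e > 0"
  obtains \<gamma> where "\<gamma> \<in> couplings \<mu> \<nu>" "tcost \<gamma> < OT \<mu> \<nu> + ennreal e"
proof -
  obtain r where "OT \<mu> \<nu> = ennreal r" "0 \<le> r"
    using assms(1) by (cases "OT \<mu> \<nu>") auto
  then have "OT \<mu> \<nu> < OT \<mu> \<nu> + ennreal e"
    using assms(2) by (simp add: ennreal_plus[symmetric] ennreal_less_iff del: ennreal_plus)
  then show thesis
    using OT_near_optimal that by blast
qed

lemma W2_translate_le:
  assumes "\<mu> \<in> P2" "\<nu> \<in> P2"
  shows "(W2 (translate a \<mu>) (translate b \<nu>))\<^sup>2 \<le>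
    (W2 \<mu> \<nu>)\<^sup>2 + (norm (a - b))\<^sup>2 + 2 * ((a - b) \<bullet> (barycenter \<mu> - barycenter \<nu>))"
proof (rule field_le_epsilon)
  fix e :: real assume "e > 0"
  have fin: "OT \<mu> \<nu> < \<infinity>" using assms by (rule OT_finite)
  obtain \<gamma> where g: "\<gamma> \<in> couplings \<mu> \<nu>" and lt: "tcost \<gamma> < OT \<mu> \<nu> + ennreal e"
    using OT_near_optimal_add[OF fin \<open>e > 0\<close>] .
  have "enn2real (tcost \<gamma>) \<le> enn2real (OT \<mu> \<nu> + ennreal e)"
    using lt fin by (intro enn2real_mono) auto
  also have "\<dots> = (W2 \<mu> \<nu>)\<^sup>2 + e"
    using fin \<open>e > 0\<close> by (simp add: W2_sq enn2real_plus)
  finally have 1: "enn2real (tcost \<gamma>) \<le> (W2 \<mu> \<nu>)\<^sup>2 + e" .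
  let ?g = "distr \<gamma> (borel \<Otimes>\<^sub>M borel) (\<lambda>p. (fst p + a, snd p + b))"
  have "(W2 (translate a \<mu>) (translate b \<nu>))\<^sup>2 \<le> enn2real (tcost ?g)"
    unfolding W2_sq using coupling_translate[OF g]
      tcost_finite[OF P2_translate[OF assms(1)] P2_translate[OF assms(2)] coupling_translate[OF g]]
    by (intro enn2real_mono OT_le_tcost) simp_all
  also note tcost_translate[OF assms g]
  finally show "(W2 (translate a \<mu>) (translate b \<nu>))\<^sup>2 \<le>
      (W2 \<mu> \<nu>)\<^sup>2 + (norm (a - b))\<^sup>2 + 2 * ((a - b) \<bullet> (barycenter \<mu> - barycenter \<nu>)) + e"
    using 1 by simp
qed

lemma W2_translate:
  assumes "\<mu> \<in> P2" "\<nu> \<in> P2"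
  shows "(W2 (translate a \<mu>) (translate b \<nu>))\<^sup>2 =
    (W2 \<mu> \<nu>)\<^sup>2 + (norm (a - b))\<^sup>2 + 2 * ((a - b) \<bullet> (barycenter \<mu> - barycenter \<nu>))"
proof (rule antisym)
  \<comment> \<open>The reverse inequality is the one already proved, applied to the inverse
    translations of the translated measures.\<close>
  have "(W2 \<mu> \<nu>)\<^sup>2 = (W2 (translate (- a) (translate a \<mu>)) (translate (- b) (translate b \<nu>)))\<^sup>2"
    using assms by (simp add: translate_translate translate_0 P2D)
  also have "\<dots> \<le> (W2 (translate a \<mu>) (translate b \<nu>))\<^sup>2 + (norm (- a - - b))\<^sup>2
      + 2 * ((- a - - b) \<bullet> (barycenter \<mu> + a - (barycenter \<nu> + b)))"
    using W2_translate_le[OF P2_translate[OF assms(1)] P2_translate[OF assms(2)], of "- a" a "- b" b]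
    by (simp only: barycenter_translate[OF assms(1)] barycenter_translate[OF assms(2)])
  finally show "(W2 \<mu> \<nu>)\<^sup>2 + (norm (a - b))\<^sup>2 + 2 * ((a - b) \<bullet> (barycenter \<mu> - barycenter \<nu>))
      \<le> (W2 (translate a \<mu>) (translate b \<nu>))\<^sup>2"
    by (simp add: power2_norm_eq_inner inner_commute algebra_simps)
qed (rule W2_translate_le[OF assms])

section \<open>Densities bounded by one\<close>

text \<open>For the Radon-Nikodym derivative \<open>g\<close>, the measure \<open>N\<close> exceeds
  \<open>M\<close> on \<open>{g > 1}\<close> by the integral of \<open>g - 1\<close>, which must
  therefore vanish. Truncating at 1 gives a version whose bounds hold at every point. Applied both
  with Lebesgue measure and with \<mu> in the role of \<open>M\<close>.\<close>

lemma dominated_measure_density: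
  assumes "sigma_finite_measure M" and fin: "emeasure N (space N) < \<infinity>" and sets: "sets N = sets M"
    and le: "\<And>E. E \<in> sets M \<Longrightarrow> emeasure N E \<le> emeasure M E"
  obtains f :: "'a \<Rightarrow> real" where "f \<in> borel_measurable M" "\<And>x. 0 \<le> f x" "\<And>x. f x \<le> 1"
    "N = density M (\<lambda>x. ennreal (f x))"
proof -
  interpret sigma_finite_measure M by fact
  have ac: "absolutely_continuous M N"
    unfolding absolutely_continuous_def
  proof
    fix E assume "E \<in> null_sets M"
    then show "E \<in> null_sets N"
      using le[of E] sets by (auto simp: null_sets_def)
  qed
  define g where "g = RN_deriv M N"
  have [measurable]: "g \<in> borel_measurable M" by (simp add: g_def)
  have N: "N = density M g"
    unfolding g_def using density_RN_deriv[OF ac sets] by simp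
  define A where "A = {x \<in> space M. g x > 1}"
  have [measurable]: "A \<in> sets M" by (simp add: A_def)
  have NA: "emeasure N A < \<infinity>"
    using emeasure_space[of N A] fin by (rule le_less_trans)
  have split: "emeasure N A = (\<integral>\<^sup>+x. (g x - 1) * indicator A x \<partial>M) + emeasure M A"
  proof -
    have "emeasure N A = (\<integral>\<^sup>+x. g x * indicator A x \<partial>M)"
      unfolding N by (rule emeasure_density) auto
    also have "\<dots> = (\<integral>\<^sup>+x. (g x - 1) * indicator A x + indicator A x \<partial>M)"
      by (intro nn_integral_cong) (auto simp: A_def indicator_def diff_add_cancel_ennreal less_imp_le)
    also have "\<dots> = (\<integral>\<^sup>+x. (g x - 1) * indicator A x \<partial>M) + emeasure M A"
      by (subst nn_integral_add) auto
    finally show ?thesis .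
  qed
  \<comment> \<open>Finiteness of \<open>N\<close> carries over to \<open>M\<close> on
    \<open>A\<close>, which permits cancelling \<open>emeasure M A\<close>.\<close>
  have MA: "emeasure M A < \<infinity>"
    using NA split by (simp add: less_top)
  have "emeasure M A + (\<integral>\<^sup>+x. (g x - 1) * indicator A x \<partial>M) \<le> emeasure M A + 0"
    using split le[of A] sets by (simp add: add.commute)
  then have "(\<integral>\<^sup>+x. (g x - 1) * indicator A x \<partial>M) = 0"
    using MA unfolding ennreal_add_left_cancel_le by (auto simp: less_top)
  then have "AE x in M. (g x - 1) * indicator A x = 0"
    by (subst nn_integral_0_iff_AE[symmetric]) measurable
  then have AE: "AE x in M. g x \<le> 1"
    by (rule AE_mp) (intro AE_I2, auto simp: A_def indicator_def diff_eq_0_iff_ennreal)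
  show thesis
  proof (rule that[of "\<lambda>x. enn2real (min 1 (g x))"])
    have lt: "min 1 (g x) < top" for x
      by (simp add: min_less_iff_disj)
    show "enn2real (min 1 (g x)) \<le> 1" for x
      using enn2real_mono[of "min 1 (g x)" 1] by simp
    show "N = density M (\<lambda>x. ennreal (enn2real (min 1 (g x))))"
      unfolding N using AE lt by (intro density_cong) (auto simp: min_def)
  qed auto
qed

text \<open>Domination by Lebesgue measure is what can be checked for the first marginal of a
  modified plan, whose density is not explicit; Radon-Nikodym recovers the density.\<close>

lemma K2_iff:
  "\<rho> \<in> K2 \<longleftrightarrow> \<rho> \<in> P2 \<and> (\<forall>E\<in>sets borel. emeasure \<rho> E \<le> emeasure lborel (E :: 'a::euclidean_space set))"
proof safe
  assume "\<rho> \<in> K2" then show "\<rho> \<in> P2" by (simp add: K2_def)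
next
  fix E :: "'a set" assume "\<rho> \<in> K2" and [measurable]: "E \<in> sets borel"
  then obtain f :: "'a \<Rightarrow> real" where [measurable]: "f \<in> borel_measurable borel"
    and f: "AE x in lborel. 0 \<le> f x \<and> f x \<le> 1" "\<rho> = density lborel (\<lambda>x. ennreal (f x))"
    by (auto simp: K2_def)
  have "emeasure \<rho> E = (\<integral>\<^sup>+x. ennreal (f x) * indicator E x \<partial>lborel)"
    unfolding f(2) by (rule emeasure_density) auto
  also have "\<dots> \<le> (\<integral>\<^sup>+x. indicator E x \<partial>lborel)"
    using f(1) by (intro nn_integral_mono_AE) (auto simp: indicator_def)
  finally show "emeasure \<rho> E \<le> emeasure lborel E" by simp
next
  assume P: "\<rho> \<in> P2" and le: "\<forall>E\<in>sets borel. emeasure \<rho> E \<le> emeasure lborel E"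
  obtain f where f: "f \<in> borel_measurable lborel" "\<And>x. 0 \<le> f x" "\<And>x. f x \<le> 1"
      "\<rho> = density lborel (\<lambda>x. ennreal (f x))"
    by (rule dominated_measure_density[of lborel \<rho>])
      (use le P2D[OF P] in \<open>auto simp: sigma_finite_lborel\<close>)
  then show "\<rho> \<in> K2"
    unfolding K2_def using P by auto
qed

text \<open>The bounds hold everywhere and not just almost everywhere, as the pointwise estimates
  below want them.\<close>

lemma K2_density:
  assumes "\<rho> \<in> K2"
  obtains f :: "'a::euclidean_space \<Rightarrow> real" where "f \<in> borel_measurable borel" "\<And>x. 0 \<le> f x" "\<And>x. f x \<le> 1"
    "\<rho> = density lborel (\<lambda>x. ennreal (f x))"
proof -
  have P: "\<rho> \<in> P2" and le: "\<forall>E\<in>sets borel. emeasure \<rho> E \<le> emeasure lborel E"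
    using assms by (auto simp: K2_iff)
  show thesis
    by (rule dominated_measure_density[of lborel \<rho>])
      (use le P2D[OF P] that in \<open>auto simp: sigma_finite_lborel\<close>)
qed

lemma K2_P2: "\<rho> \<in> K2 \<Longrightarrow> \<rho> \<in> P2"
  by (simp add: K2_def)

section \<open>Competitors obtained by modifying plans\<close>

text \<open>Makes a competitor out of a plan: the source is whatever first marginal the plan has.
  Its total mass comes from the second marginal, its second moment from the finite cost.\<close>

lemma couplings_distr_fst:
  assumes s: "sets \<gamma> = sets (borel \<Otimes>\<^sub>M borel)" and mu: "\<mu> \<in> P2"
    and snd: "\<And>E. E \<in> sets borel \<Longrightarrow> (\<integral>\<^sup>+p. indicator E (snd p) \<partial>\<gamma>) = emeasure \<mu> E"
    and fst: "\<And>E. E \<in> sets borel \<Longrightarrow> (\<integral>\<^sup>+p. indicator E (fst p) \<partial>\<gamma>) \<le> emeasure lborel (E :: 'a::euclidean_space set)"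
    and fin: "tcost \<gamma> < \<infinity>"
  shows "distr \<gamma> borel fst \<in> K2" "\<gamma> \<in> couplings (distr \<gamma> borel fst) \<mu>"
proof -
  note s[measurable_cong]
  have em: "emeasure (distr \<gamma> borel fst) E = (\<integral>\<^sup>+p. indicator E (fst p) \<partial>\<gamma>)" if [measurable]: "E \<in> sets borel" for E :: "'a set"
  proof -
    have "emeasure (distr \<gamma> borel fst) E = (\<integral>\<^sup>+x. indicator E x \<partial>distr \<gamma> borel fst)" by simp
    also have "\<dots> = (\<integral>\<^sup>+p. indicator E (fst p) \<partial>\<gamma>)" by (subst nn_integral_distr) (simp_all del: nn_integral_indicator)
    finally show ?thesis .
  qed
  have 1: "emeasure (distr \<gamma> borel fst) UNIV = 1"
    using em[of UNIV] snd[of UNIV] P2D[OF mu] by simp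
  show c: "\<gamma> \<in> couplings (distr \<gamma> borel fst) \<mu>"
    by (rule couplingsI) (use s mu snd em 1 in \<open>auto simp: P2D\<close>)
  have "distr \<gamma> borel fst \<in> P2"
    using coupling_fst_moment[OF c] fin P2_second_moment_finite[OF mu] 1
    by (intro P2I) (auto simp: ennreal_mult_less_top intro: le_less_trans)
  then show "distr \<gamma> borel fst \<in> K2"
    using em fst by (auto simp: K2_iff)
qed

text \<open>The weight \<open>w\<close> is the fraction of the mass at \<open>p = (x, y)\<close> whose first coordinate is moved
  from \<open>x\<close> to \<open>T p\<close>.\<close>

lemma replacement_inequality:
  fixes w :: "'a::euclidean_space \<times> 'a \<Rightarrow> real"
  assumes mu: "\<mu> \<in> P2" and g: "\<gamma> \<in> couplings \<rho> \<mu>"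
    and min: "\<And>\<sigma>. \<sigma> \<in> K2 \<Longrightarrow> m \<le> OT \<sigma> \<mu>"
    and near: "tcost \<gamma> \<le> m + e" "tcost \<gamma> < \<infinity>"
    and [measurable]: "w \<in> borel_measurable (borel \<Otimes>\<^sub>M borel)" "T \<in> measurable (borel \<Otimes>\<^sub>M borel) borel"
    and w: "\<And>p. 0 \<le> w p" "\<And>p. w p \<le> 1"
    and fst: "\<And>E. E \<in> sets borel \<Longrightarrow>
      (\<integral>\<^sup>+p. ennreal (1 - w p) * indicator E (fst p) + ennreal (w p) * indicator E (T p) \<partial>\<gamma>) \<le> emeasure lborel E"
  shows "(\<integral>\<^sup>+p. ennreal (w p) * ennreal ((dist (fst p) (snd p))\<^sup>2) \<partial>\<gamma>)
    \<le> (\<integral>\<^sup>+p. ennreal (w p) * ennreal ((dist (T p) (snd p))\<^sup>2) \<partial>\<gamma>) + e"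
    (is "?B \<le> ?B' + e")
proof (cases "?B' = \<infinity>")
  case False
  note couplingsD(2)[OF g, measurable_cong]
  define \<gamma>' where "\<gamma>' = add_measure (density \<gamma> (\<lambda>p. ennreal (1 - w p)))
    (distr (density \<gamma> (\<lambda>p. ennreal (w p))) (borel \<Otimes>\<^sub>M borel) (\<lambda>p. (T p, snd p)))"
  have s': "sets \<gamma>' = sets (borel \<Otimes>\<^sub>M borel)"
    by (simp add: \<gamma>'_def couplingsD[OF g])
  have int: "(\<integral>\<^sup>+p. f p \<partial>\<gamma>') = (\<integral>\<^sup>+p. ennreal (1 - w p) * f p + ennreal (w p) * f (T p, snd p) \<partial>\<gamma>)"
    if [measurable]: "f \<in> borel_measurable (borel \<Otimes>\<^sub>M borel)" for f
    unfolding \<gamma>'_def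
    by (simp add: nn_integral_add_measure couplingsD[OF g] nn_integral_density nn_integral_distr nn_integral_add)
  \<comment> \<open>Cost of the mass left in place. It occurs in the costs of both plans and is
    finite, so it cancels at the end.\<close>
  define A where "A = (\<integral>\<^sup>+p. ennreal (1 - w p) * ennreal ((dist (fst p) (snd p))\<^sup>2) \<partial>\<gamma>)"
  have one: "ennreal (1 - w p) * c + ennreal (w p) * c = c" for p c
    using w[of p] by (simp add: distrib_right[symmetric] ennreal_plus[symmetric] del: ennreal_plus)
  have c': "tcost \<gamma>' = A + ?B'"
    unfolding tcost_def A_def by (subst int) (auto intro!: nn_integral_add)
  have c: "tcost \<gamma> = A + ?B"
    unfolding tcost_def A_def by (subst nn_integral_add[symmetric]) (auto simp: one)
  have A: "A < \<infinity>" using near(2) c by (auto simp: less_top)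
  have fin: "tcost \<gamma>' < \<infinity>" using c' A False by (auto simp: less_top)
  have snd: "(\<integral>\<^sup>+p. indicator E (snd p) \<partial>\<gamma>') = emeasure \<mu> E" if [measurable]: "E \<in> sets borel" for E
    using coupling_snd[OF g, of "indicator E"] that by (simp add: int one P2D[OF mu])
  have fst': "(\<integral>\<^sup>+p. indicator E (fst p) \<partial>\<gamma>') \<le> emeasure lborel E" if [measurable]: "E \<in> sets borel" for E
    using fst[OF that] by (simp add: int)
  note coup = couplings_distr_fst[OF s' mu snd fst' fin]
  have "A + ?B \<le> m + e" using near c by simp
  moreover have "m \<le> A + ?B'"
    using order.trans[OF min[OF coup(1)] OT_le_tcost[OF coup(2)]] unfolding c' .
  ultimately have "A + ?B \<le> (A + ?B') + e"
    by (blast intro: order.trans add_right_mono)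
  then have "A + ?B \<le> A + (?B' + e)" by (simp only: add.assoc)
  then show ?thesis
    using A unfolding ennreal_add_left_cancel_le by (auto simp: less_top)
qed simp

text \<open>Convexity in the source: the average of two nearly optimal plans is a plan for the
  averaged density. The common bound \<open>c\<close> is the form in which sublevel sets are seen to
  be closed under midpoints.\<close>

lemma OT_midpoint_le:
  fixes f0 f1 :: "'a::euclidean_space \<Rightarrow> real"
  assumes mu: "\<mu> \<in> P2"
    and [measurable]: "f0 \<in> borel_measurable borel" "f1 \<in> borel_measurable borel"
    and nn: "\<And>x. 0 \<le> f0 x" "\<And>x. 0 \<le> f1 x"
    and K: "density lborel (\<lambda>x. ennreal (f0 x)) \<in> K2" "density lborel (\<lambda>x. ennreal (f1 x)) \<in> K2"
    and c: "OT (density lborel (\<lambda>x. ennreal (f0 x))) \<mu> \<le> c" "OT (density lborel (\<lambda>x. ennreal (f1 x))) \<mu> \<le> c" "c < \<infinity>"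
  shows "density lborel (\<lambda>x. ennreal ((f0 x + f1 x) / 2)) \<in> K2"
    "OT (density lborel (\<lambda>x. ennreal ((f0 x + f1 x) / 2))) \<mu> \<le> c"
proof -
  let ?p = "density lborel (\<lambda>x. ennreal (f0 x))" and ?q = "density lborel (\<lambda>x. ennreal (f1 x))"
  let ?r = "density lborel (\<lambda>x. ennreal ((f0 x + f1 x) / 2))"
  have fin: "OT ?p \<mu> < \<infinity>" "OT ?q \<mu> < \<infinity>"
    using c by (auto intro: le_less_trans)
  have half: "ennreal (1/2) * c + ennreal (1/2) * c = c" for c
    unfolding distrib_right[symmetric] by (subst ennreal_plus[symmetric]) simp_all
  have *: "?r \<in> K2 \<and> OT ?r \<mu> \<le> c + ennreal e" if e: "e > 0" for e
  proof -
    obtain \<gamma>0 where g0: "\<gamma>0 \<in> couplings ?p \<mu>" "tcost \<gamma>0 < OT ?p \<mu> + ennreal e"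
      using OT_near_optimal_add[OF fin(1) e] .
    obtain \<gamma>1 where g1: "\<gamma>1 \<in> couplings ?q \<mu>" "tcost \<gamma>1 < OT ?q \<mu> + ennreal e"
      using OT_near_optimal_add[OF fin(2) e] .
    note couplingsD(2)[OF g0(1), measurable_cong] couplingsD(2)[OF g1(1), measurable_cong]
    define \<gamma> where "\<gamma> = add_measure (density \<gamma>0 (\<lambda>p. ennreal (1/2))) (density \<gamma>1 (\<lambda>p. ennreal (1/2)))"
    have s: "sets \<gamma> = sets (borel \<Otimes>\<^sub>M borel)"
      by (simp add: \<gamma>_def couplingsD[OF g0(1)])
    have int: "(\<integral>\<^sup>+p. f p \<partial>\<gamma>) = ennreal (1/2) * (\<integral>\<^sup>+p. f p \<partial>\<gamma>0) + ennreal (1/2) * (\<integral>\<^sup>+p. f p \<partial>\<gamma>1)"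
      if [measurable]: "f \<in> borel_measurable (borel \<Otimes>\<^sub>M borel)" for f
      unfolding \<gamma>_def
      by (simp add: nn_integral_add_measure couplingsD[OF g0(1)] couplingsD[OF g1(1)] nn_integral_density nn_integral_cmult del: ennreal_half)
    have "tcost \<gamma> \<le> ennreal (1/2) * (c + ennreal e) + ennreal (1/2) * (c + ennreal e)"
      unfolding tcost_def[of \<gamma>] using g0(2) g1(2) c
      by (subst int) (auto simp: tcost_def[symmetric] simp del: ennreal_half
        intro!: add_mono mult_left_mono order.trans[OF less_imp_le[OF g0(2)]] order.trans[OF less_imp_le[OF g1(2)]])
    then have cost: "tcost \<gamma> \<le> c + ennreal e" by (simp only: half)
    have snd: "(\<integral>\<^sup>+p. indicator E (snd p) \<partial>\<gamma>) = emeasure \<mu> E" if [measurable]: "E \<in> sets borel" for E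
      using coupling_snd[OF g0(1), of "indicator E"] coupling_snd[OF g1(1), of "indicator E"]
      by (simp add: int P2D[OF mu] half del: ennreal_half)
    have dens: "ennreal ((f0 x + f1 x) / 2) = ennreal (1/2) * ennreal (f0 x) + ennreal (1/2) * ennreal (f1 x)" for x
      using nn[of x] by (simp add: ennreal_mult'[symmetric] ennreal_plus[symmetric] add_divide_distrib del: ennreal_plus ennreal_half)
    have fst: "(\<integral>\<^sup>+p. indicator E (fst p) \<partial>\<gamma>) = emeasure ?r E" if [measurable]: "E \<in> sets borel" for E
    proof -
      have "(\<integral>\<^sup>+p. indicator E (fst p) \<partial>\<gamma>) = ennreal (1/2) * emeasure ?p E + ennreal (1/2) * emeasure ?q E"
        using coupling_fst[OF g0(1), of "indicator E"] coupling_fst[OF g1(1), of "indicator E"]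
        by (simp add: int del: ennreal_half)
      also have "\<dots> = emeasure ?r E"
        by (simp add: emeasure_density nn_integral_cmult[symmetric] nn_integral_add[symmetric] dens distrib_right mult.assoc del: ennreal_half)
      finally show ?thesis .
    qed
    have "emeasure ?r E \<le> emeasure lborel E" if [measurable]: "E \<in> sets borel" for E
    proof -
      have "emeasure ?p E \<le> emeasure lborel E" "emeasure ?q E \<le> emeasure lborel E"
        using K that by (auto simp: K2_iff)
      then have "ennreal (1/2) * emeasure ?p E + ennreal (1/2) * emeasure ?q E \<le>
          ennreal (1/2) * emeasure lborel E + ennreal (1/2) * emeasure lborel E"
        by (intro add_mono mult_left_mono) auto
      also have "ennreal (1/2) * emeasure ?p E + ennreal (1/2) * emeasure ?q E = emeasure ?r E"
        by (simp add: emeasure_density nn_integral_cmult[symmetric] nn_integral_add[symmetric] dens distrib_right mult.assoc del: ennreal_half)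
      finally show ?thesis by (simp only: half)
    qed
    then have fst_le: "(\<integral>\<^sup>+p. indicator E (fst p) \<partial>\<gamma>) \<le> emeasure lborel E" if "E \<in> sets borel" for E
      using fst that by simp
    have "tcost \<gamma> < \<infinity>" using cost c(3) by (auto intro: le_less_trans)
    note coup = couplings_distr_fst[OF s mu snd fst_le this]
    have eq: "distr \<gamma> borel fst = ?r"
    proof (rule measure_eqI)
      fix E assume "E \<in> sets (distr \<gamma> borel fst)"
      then have [measurable]: "E \<in> sets borel" by simp
      have "emeasure (distr \<gamma> borel fst) E = (\<integral>\<^sup>+x. indicator E x \<partial>distr \<gamma> borel fst)" by simp
      also have "\<dots> = (\<integral>\<^sup>+p. indicator E (fst p) \<partial>\<gamma>)"
        by (rule coupling_fst[OF coup(2), symmetric]) simp_all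
      also have "\<dots> = emeasure ?r E" by (rule fst) simp
      finally show "emeasure (distr \<gamma> borel fst) E = emeasure ?r E" .
    qed simp
    show ?thesis
      using coup(1)[unfolded eq] order.trans[OF OT_le_tcost[OF coup(2)[unfolded eq]] cost] by blast
  qed
  from *[of 1] show "?r \<in> K2" by simp
  show "OT ?r \<mu> \<le> c"
    by (rule ennreal_le_epsilon) (use * in blast)
qed

section \<open>Slackness of the density constraint\<close>

text \<open>Minimality in \<open>ennreal\<close>, where costs of plans are compared directly; for
  \<mu> in \<open>P2\<close> it agrees with the real-valued \<open>is_arg_min\<close> of
  \<open>proj_K2\<close>.\<close>

definition K2_minimizer :: "'a::euclidean_space measure \<Rightarrow> 'a measure \<Rightarrow> bool" where
  "K2_minimizer \<mu> \<rho> \<longleftrightarrow> \<rho> \<in> K2 \<and> (\<forall>\<sigma>\<in>K2. OT \<rho> \<mu> \<le> OT \<sigma> \<mu>)"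

section \<open>Small translations and thickenings of compact sets\<close>

lemma emeasure_lborel_shift:
  assumes [measurable]: "A \<in> sets borel"
  shows "emeasure lborel {x. x + v \<in> A} = emeasure lborel (A :: 'a::euclidean_space set)"
proof -
  have "emeasure lborel A = emeasure (distr lborel borel ((+) v)) A"
    by (simp add: lborel_distr_plus)
  also have "\<dots> = emeasure lborel ((+) v -` A \<inter> space lborel)"
    by (rule emeasure_distr) auto
  also have "(+) v -` A \<inter> space lborel = {x. x + v \<in> A}"
    by (auto simp: add.commute)
  finally show ?thesis by simp
qed

text \<open>Outer regularity gives an open \<open>U\<close> around \<open>C\<close> with
  \<open>U - C\<close> small. A short shift keeps \<open>C\<close> inside \<open>U\<close>, so
  points leaving \<open>C\<close> land in \<open>U - C\<close>, and translation invariance bounds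
  the set they come from.\<close>

lemma compact_shift_leaks_little:
  fixes C :: "'a::euclidean_space set"
  assumes C: "compact C" and e: "e > 0"
  obtains t where "t > 0" "\<And>v. norm v < t \<Longrightarrow> emeasure lborel {x \<in> C. x + v \<notin> C} \<le> ennreal e"
proof -
  have [measurable]: "C \<in> sets borel" using C by (simp add: compact_imp_closed)
  obtain U where U: "open U" "C \<subseteq> U" "emeasure lebesgue (U - C) < ennreal e"
    using sets_lebesgue_outer_open[of C e] e by (metis \<open>C \<in> sets borel\<close> sets_completionI_sets sets_lborel)
  have [measurable]: "U \<in> sets borel" using U by simp
  obtain t where t: "t > 0" "(\<Union>x\<in>C. ball x t) \<subseteq> U"
    using compact_subset_open_imp_ball_epsilon_subset[OF C U(1,2)] by blast
  show thesis
  proof (rule that[OF t(1)])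
    fix v :: 'a assume v: "norm v < t"
    have "{x \<in> C. x + v \<notin> C} \<subseteq> {x. x + v \<in> U - C}"
      using t(2) v by (force simp: dist_norm)
    then have "emeasure lborel {x \<in> C. x + v \<notin> C} \<le> emeasure lborel {x. x + v \<in> U - C}"
      by (rule emeasure_mono) measurable
    also have "\<dots> = emeasure lborel (U - C)"
      by (rule emeasure_lborel_shift) measurable
    also have "\<dots> \<le> ennreal e"
      using U(3) by simp
    finally show "emeasure lborel {x \<in> C. x + v \<notin> C} \<le> ennreal e" .
  qed
qed

lemma closed_thickening: "closed {y. infdist y C \<le> r}"
  by (intro closed_Collect_le continuous_at_imp_continuous_on ballI continuous_infdist) auto

text \<open>Continuity from above along closed thickenings, whose intersection is the closed set
  \<open>C\<close>. The empty set is excluded because \<open>infdist\<close> to it is 0 by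
  convention, which would make each thickening the whole space.\<close>

lemma emeasure_le_of_thickenings:
  fixes C :: "'a::euclidean_space set"
  assumes C: "compact C" and M: "sets M = sets borel" "emeasure M UNIV < \<infinity>"
    and le: "\<And>r. r > 0 \<Longrightarrow> a \<le> emeasure M {y. infdist y C \<le> r}"
    and ne: "C \<noteq> {}"
  shows "a \<le> emeasure M C"
proof -
  let ?B = "\<lambda>n. {y. infdist y C \<le> 1 / real (Suc n)}"
  have [measurable]: "?B n \<in> sets M" for n
    unfolding M(1) by (rule borel_closed[OF closed_thickening])
  have "(INF n. emeasure M (?B n)) = emeasure M (\<Inter>n. ?B n)"
  proof (rule INF_emeasure_decseq)
    have "1 / real (Suc n) \<le> 1 / real (Suc m)" if "m \<le> n" for m n
      using that by (simp add: frac_le)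
    then show "decseq ?B"
      by (auto simp: decseq_def simp del: of_nat_Suc intro: order.trans)
    show "emeasure M (?B n) \<noteq> \<infinity>" for n
      using le_less_trans[OF emeasure_space M(2)[unfolded sets_eq_imp_space_eq[OF M(1), unfolded space_borel, symmetric]]]
      by (simp add: less_top)
  qed (auto simp: M(1) intro!: borel_closed closed_thickening)
  also have "(\<Inter>n. ?B n) = C"
  proof (intro equalityI subsetI)
    fix y assume "y \<in> (\<Inter>n. ?B n)"
    then have "infdist y C \<le> 1 / real (Suc n)" for n by blast
    then have "infdist y C \<le> 0"
      by (metis inverse_eq_divide not_le reals_Archimedean)
    then have "infdist y C = 0" using infdist_nonneg[of y C] by linarith
    then show "y \<in> C"
      using in_closed_iff_infdist_zero[OF compact_imp_closed[OF C] ne] by simp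
  next
    fix y assume "y \<in> C" then show "y \<in> (\<Inter>n. ?B n)" by simp
  qed
  finally have "(INF n. emeasure M (?B n)) = emeasure M C" .
  moreover have "a \<le> (INF n. emeasure M (?B n))"
    by (intro INF_greatest le) simp
  ultimately show ?thesis by simp
qed

text \<open>Where the density stays below \<open>1\<close> there is room to move mass from \<open>x\<close> to \<open>x + t u\<close>,
  which brings it closer to its target \<open>y\<close>.\<close>

lemma directional_displacement_small:
  fixes C :: "'a::euclidean_space set"
  assumes mu: "\<mu> \<in> P2" and min: "K2_minimizer \<mu> \<rho>"
    and C: "compact C" and d: "0 < d" "d \<le> 1"
    and gap: "\<And>E. E \<in> sets borel \<Longrightarrow> E \<subseteq> C \<Longrightarrow> emeasure \<rho> E + ennreal d * emeasure lborel E \<le> emeasure lborel E"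
    and u: "norm u = 1" and c: "c > 0" and e: "e > 0"
  shows "\<forall>\<^sub>F \<eta> in at_right 0. \<forall>\<gamma>\<in>couplings \<rho> \<mu>. tcost \<gamma> \<le> OT \<rho> \<mu> + ennreal \<eta> \<longrightarrow>
    emeasure \<gamma> {p. fst p \<in> C \<and> c < u \<bullet> (snd p - fst p)} \<le> ennreal e"
proof -
  have K: "\<rho> \<in> K2" and P: "\<rho> \<in> P2" and opt: "\<And>\<sigma>. \<sigma> \<in> K2 \<Longrightarrow> OT \<rho> \<mu> \<le> OT \<sigma> \<mu>"
    using min by (auto simp: K2_minimizer_def K2_P2)
  have dom: "emeasure \<rho> E \<le> emeasure lborel E" if "E \<in> sets borel" for E
    using K that by (auto simp: K2_iff)
  note P2D(2)[OF P, measurable_cong]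
  have [measurable]: "C \<in> sets borel" using C by (simp add: compact_imp_closed)
  obtain t0 where t0: "t0 > 0" "\<And>v. norm v < t0 \<Longrightarrow> emeasure lborel {x \<in> C. x + v \<notin> C} \<le> ennreal (e / 2)"
    using compact_shift_leaks_little[OF C, of "e / 2"] e by auto
  \<comment> \<open>\<open>t < t0\<close> keeps the mass shifted out of \<open>C\<close> below
    \<open>e / 2\<close>; \<open>t \<le> c\<close> makes the quadratic term of the shifted cost at
    most \<open>t * c\<close>, half of what the linear term gains.\<close>
  define t where "t = min (t0 / 2) c"
  have t: "t > 0" "t < t0" "t \<le> c" using t0 c by (auto simp: t_def)
  define v where "v = t *\<^sub>R u"
  have v: "norm v < t0" using t u by (simp add: v_def)
  show ?thesis
  proof (rule eventually_at_rightI)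
    \<comment> \<open>The shift saves at least \<open>t * c\<close> per unit of moved mass, and the
      moved mass is \<open>d * emeasure \<gamma> S\<close>, so a defect below this threshold forces
      \<open>emeasure \<gamma> S\<close> to be at most \<open>e / 2\<close>. The other half of
      \<open>e\<close> pays for points that the shift carries out of \<open>C\<close>.\<close>
    show "(0::real) < d * t * c * (e / 2)" using d t c e by simp
    fix \<eta> assume "\<eta> \<in> {0<..<d * t * c * (e / 2)}"
    then have \<eta>: "0 < \<eta>" "\<eta> < d * t * c * (e / 2)" by auto
    show "\<forall>\<gamma>\<in>couplings \<rho> \<mu>. tcost \<gamma> \<le> OT \<rho> \<mu> + ennreal \<eta> \<longrightarrow>
      emeasure \<gamma> {p. fst p \<in> C \<and> c < u \<bullet> (snd p - fst p)} \<le> ennreal e"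
    proof (intro ballI impI)
      fix \<gamma> assume g: "\<gamma> \<in> couplings \<rho> \<mu>" and near: "tcost \<gamma> \<le> OT \<rho> \<mu> + ennreal \<eta>"
      note s = couplingsD(2)[OF g, measurable_cong]
      \<comment> \<open>The shifted point must stay in \<open>C\<close>, since slack is known only
        there.\<close>
      define S where "S = {p. fst p \<in> C \<and> fst p + v \<in> C \<and> c < u \<bullet> (snd p - fst p)}"
      have [measurable]: "S \<in> sets (borel \<Otimes>\<^sub>M borel)"
      proof -
        have "{p \<in> space (borel \<Otimes>\<^sub>M borel). fst p \<in> C \<and> fst p + v \<in> C \<and> c < u \<bullet> (snd p - fst p)}
            \<in> sets (borel \<Otimes>\<^sub>M borel)"
          by measurable
        then show ?thesis by (simp add: S_def space_pair_measure)
      qed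
      define w where "w p = d * indicator S p" for p :: "'a \<times> 'a"
      have [measurable]: "w \<in> borel_measurable (borel \<Otimes>\<^sub>M borel)"
        unfolding w_def by measurable
      have fin: "tcost \<gamma> < \<infinity>" by (rule tcost_finite[OF P mu g])
      \<comment> \<open>The moved mass lands in \<open>C\<close> and is at most \<open>d\<close>
        times a translate of \<rho>, hence at most \<open>d\<close> times Lebesgue measure; the
        slack of \<rho> on \<open>C\<close> absorbs it.\<close>
      have bound: "(\<integral>\<^sup>+p. ennreal (1 - w p) * indicator E (fst p) + ennreal (w p) * indicator E (fst p + v) \<partial>\<gamma>)
          \<le> emeasure lborel E" if [measurable]: "E \<in> sets borel" for E
      proof -
        have "(\<integral>\<^sup>+p. ennreal (1 - w p) * indicator E (fst p) + ennreal (w p) * indicator E (fst p + v) \<partial>\<gamma>)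
          \<le> (\<integral>\<^sup>+p. indicator E (fst p) + ennreal d * indicator {x. x + v \<in> E \<inter> C} (fst p) \<partial>\<gamma>)"
          using d by (intro nn_integral_mono add_mono) (auto simp: w_def S_def indicator_def ennreal_le_1)
        also have "\<dots> = emeasure \<rho> E + ennreal d * emeasure \<rho> {x. x + v \<in> E \<inter> C}"
          using coupling_fst[OF g, of "indicator E"] coupling_fst[OF g, of "indicator {x. x + v \<in> E \<inter> C}"]
          by (simp add: nn_integral_add nn_integral_cmult)
        also have "\<dots> \<le> emeasure \<rho> E + ennreal d * emeasure lborel (E \<inter> C)"
          using dom[of "{x. x + v \<in> E \<inter> C}"] emeasure_lborel_shift[of "E \<inter> C" v]
          by (intro add_mono mult_left_mono) auto
        also have "emeasure \<rho> E = emeasure \<rho> (E - C) + emeasure \<rho> (E \<inter> C)"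
          by (subst plus_emeasure) (auto simp: Un_Diff_Int intro!: arg_cong[where f="emeasure \<rho>"])
        also have "emeasure \<rho> (E - C) + emeasure \<rho> (E \<inter> C) + ennreal d * emeasure lborel (E \<inter> C)
            \<le> emeasure lborel (E - C) + emeasure lborel (E \<inter> C)"
          unfolding add.assoc by (intro add_mono dom gap) auto
        also have "\<dots> = emeasure lborel E"
          by (subst plus_emeasure) (auto simp: Un_Diff_Int intro!: arg_cong[where f="emeasure lborel"])
        finally show ?thesis .
      qed
      have ineq: "(\<integral>\<^sup>+p. ennreal (w p) * ennreal ((dist (fst p) (snd p))\<^sup>2) \<partial>\<gamma>)
          \<le> (\<integral>\<^sup>+p. ennreal (w p) * ennreal ((dist (fst p + v) (snd p))\<^sup>2) \<partial>\<gamma>) + ennreal \<eta>"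
        (is "?L \<le> ?R + _")
        by (rule replacement_inequality[OF mu g opt near fin]) (use d bound in \<open>auto simp: w_def indicator_def\<close>)
      have gain: "(dist (fst p + v) (snd p))\<^sup>2 + t * c \<le> (dist (fst p) (snd p))\<^sup>2" if "p \<in> S" for p
      proof -
        have "(dist (fst p + v) (snd p))\<^sup>2 = (dist (fst p) (snd p))\<^sup>2 - 2 * t * (u \<bullet> (snd p - fst p)) + t * t"
          using u by (simp add: dist_norm v_def power2_norm_eq_inner inner_commute algebra_simps norm_eq_1)
        moreover have "t * c \<le> t * (u \<bullet> (snd p - fst p))"
          using that t by (intro mult_left_mono) (auto simp: S_def)
        moreover have "t * t \<le> t * c" using t by (intro mult_left_mono) auto
        ultimately show ?thesis by linarith
      qed
      have "?R + ennreal (d * t * c) * emeasure \<gamma> S = (\<integral>\<^sup>+p. ennreal (w p) * ennreal ((dist (fst p + v) (snd p))\<^sup>2)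
          + ennreal (d * t * c) * indicator S p \<partial>\<gamma>)"
        by (simp add: nn_integral_add nn_integral_cmult)
      also have "\<dots> \<le> ?L"
      proof (rule nn_integral_mono)
        fix p
        show "ennreal (w p) * ennreal ((dist (fst p + v) (snd p))\<^sup>2) + ennreal (d * t * c) * indicator S p
            \<le> ennreal (w p) * ennreal ((dist (fst p) (snd p))\<^sup>2)"
        proof (cases "p \<in> S")
          case True
          have "ennreal d * ennreal ((dist (fst p + v) (snd p))\<^sup>2) + ennreal (d * t * c) =
              ennreal (d * ((dist (fst p + v) (snd p))\<^sup>2 + t * c))"
            using d t c by (simp add: ennreal_mult'[symmetric] ennreal_plus[symmetric] algebra_simps del: ennreal_plus)
          also have "\<dots> \<le> ennreal (d * (dist (fst p) (snd p))\<^sup>2)"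
            using gain[OF True] d by (intro ennreal_leI mult_left_mono) auto
          finally show ?thesis using True d by (simp add: w_def ennreal_mult')
        qed (simp add: w_def)
      qed
      finally have 0: "?R + ennreal (d * t * c) * emeasure \<gamma> S \<le> ?L" .
      then have 1: "?R + ennreal (d * t * c) * emeasure \<gamma> S \<le> ?R + ennreal \<eta>"
        using ineq by (rule order.trans)
      \<comment> \<open>\<open>?R\<close> must be seen to be finite before it is cancelled from both
        sides.\<close>
      have "?L \<le> tcost \<gamma>"
        unfolding tcost_def using d mult_right_mono[of "ennreal d" 1]
        by (intro nn_integral_mono) (auto simp: w_def indicator_def ennreal_le_1)
      moreover have "?R \<le> ?L"
        using 0 by (rule order.trans[rotated]) simp
      ultimately have "?R < \<infinity>" using fin by (auto intro: le_less_trans)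
      then have "ennreal (d * t * c) * emeasure \<gamma> S \<le> ennreal \<eta>"
        using 1 unfolding ennreal_add_left_cancel_le by (auto simp: less_top)
      also have "\<dots> \<le> ennreal (d * t * c) * ennreal (e / 2)"
        using \<eta> d t c e by (simp add: ennreal_mult'[symmetric])
      finally have S: "emeasure \<gamma> S \<le> ennreal (e / 2)"
        using d t c by (subst (asm) ennreal_mult_le_mult_iff) (auto)
      have "{p \<in> space \<gamma>. fst p \<in> C \<and> fst p + v \<notin> C} \<in> sets \<gamma>" by measurable
      then have L: "{p. fst p \<in> C \<and> fst p + v \<notin> C} \<in> sets \<gamma>" by (simp add: couplingsD(3)[OF g])
      have "emeasure \<gamma> {p. fst p \<in> {x \<in> C. x + v \<notin> C}} = (\<integral>\<^sup>+p. indicator {x \<in> C. x + v \<notin> C} (fst p) \<partial>\<gamma>)"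
        using L by (simp add: nn_integral_indicator[OF L, symmetric] indicator_def)
      also have "\<dots> = emeasure \<rho> {x \<in> C. x + v \<notin> C}"
        using coupling_fst[OF g, of "indicator {x \<in> C. x + v \<notin> C}"] by simp
      also have "\<dots> \<le> emeasure lborel {x \<in> C. x + v \<notin> C}" by (rule dom) measurable
      also have "\<dots> \<le> ennreal (e / 2)" by (rule t0(2)[OF v])
      finally have leak: "emeasure \<gamma> {p. fst p \<in> {x \<in> C. x + v \<notin> C}} \<le> ennreal (e / 2)" .
      have "emeasure \<gamma> {p. fst p \<in> C \<and> c < u \<bullet> (snd p - fst p)} \<le> emeasure \<gamma> (S \<union> {p. fst p \<in> {x \<in> C. x + v \<notin> C}})"
      proof (rule emeasure_mono)
        show "S \<union> {p. fst p \<in> {x \<in> C. x + v \<notin> C}} \<in> sets \<gamma>" using L by simp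
      qed (auto simp: S_def)
      also have "\<dots> \<le> emeasure \<gamma> S + emeasure \<gamma> {p. fst p \<in> {x \<in> C. x + v \<notin> C}}"
        using L by (intro emeasure_subadditive) auto
      also have "\<dots> \<le> ennreal (e / 2) + ennreal (e / 2)" by (intro add_mono S leak)
      also have "\<dots> = ennreal e" using e by (simp add: ennreal_plus[symmetric] del: ennreal_plus)
      finally show "emeasure \<gamma> {p. fst p \<in> C \<and> c < u \<bullet> (snd p - fst p)} \<le> ennreal e" .
    qed
  qed
qed

text \<open>A displacement longer than \<open>r\<close> has a coordinate of absolute value above
  \<open>r / D\<close>, with \<open>D\<close> the dimension. Off the finitely many events of this
  kind, all of small mass for nearly optimal plans, mass starting in \<open>C\<close> ends in the
  \<open>r\<close>-thickening of \<open>C\<close>. Then the error and \<open>r\<close> tend to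
  0.\<close>

lemma minimizer_le_target_on_gap:
  fixes C :: "'a::euclidean_space set"
  assumes mu: "\<mu> \<in> P2" and min: "K2_minimizer \<mu> \<rho>"
    and C: "compact C" and d: "0 < d" "d \<le> 1"
    and gap: "\<And>E. E \<in> sets borel \<Longrightarrow> E \<subseteq> C \<Longrightarrow> emeasure \<rho> E + ennreal d * emeasure lborel E \<le> emeasure lborel E"
  shows "emeasure \<rho> C \<le> emeasure \<mu> C"
proof (cases "C = {}")
  case False
  have P: "\<rho> \<in> P2" using min by (auto simp: K2_minimizer_def K2_P2)
  have [measurable]: "C \<in> sets borel" using C by (simp add: compact_imp_closed)
  define D where "D = real DIM('a)"
  have D: "D > 0" by (simp add: D_def)
  define U where "U = Basis \<union> uminus ` (Basis :: 'a set)"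
  have U: "finite U" "\<And>u. u \<in> U \<Longrightarrow> norm u = 1" "U \<noteq> {}" by (auto simp: U_def)
  show ?thesis
  proof (rule emeasure_le_of_thickenings[OF C _ _ _ False])
    fix r :: real assume r: "r > 0"
    define N where "N = {y. infdist y C \<le> r}"
    have [measurable]: "N \<in> sets borel"
      unfolding N_def by (rule borel_closed[OF closed_thickening])
    have "emeasure \<rho> C \<le> emeasure \<mu> N + ennreal e" if e: "e > 0" for e
    proof -
      \<comment> \<open>The error is shared equally among the directions in \<open>U\<close>. As
        these are finitely many, the eventual form of the directional estimate yields one \<eta> for
        all of them.\<close>
      define e' where "e' = e / real (card U)"
      have e': "e' > 0" using e U by (simp add: e'_def card_gt_0_iff)
      have "\<forall>\<^sub>F \<eta> in at_right 0. \<forall>u\<in>U. \<forall>\<gamma>\<in>couplings \<rho> \<mu>. tcost \<gamma> \<le> OT \<rho> \<mu> + ennreal \<eta> \<longrightarrow>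
          emeasure \<gamma> {p. fst p \<in> C \<and> r / D < u \<bullet> (snd p - fst p)} \<le> ennreal e'"
        using r D e' U
        by (intro eventually_ball_finite ballI directional_displacement_small[OF mu min C d gap]) auto
      then have "\<forall>\<^sub>F \<eta> in at_right (0::real). 0 < \<eta> \<and> (\<forall>u\<in>U. \<forall>\<gamma>\<in>couplings \<rho> \<mu>. tcost \<gamma> \<le> OT \<rho> \<mu> + ennreal \<eta> \<longrightarrow>
          emeasure \<gamma> {p. fst p \<in> C \<and> r / D < u \<bullet> (snd p - fst p)} \<le> ennreal e')"
        using eventually_at_right_less[of "0::real"] by eventually_elim auto
      then obtain \<eta> :: real where \<eta>: "\<eta> > 0"
        "\<And>u \<gamma>. u \<in> U \<Longrightarrow> \<gamma> \<in> couplings \<rho> \<mu> \<Longrightarrow> tcost \<gamma> \<le> OT \<rho> \<mu> + ennreal \<eta> \<Longrightarrow>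
          emeasure \<gamma> {p. fst p \<in> C \<and> r / D < u \<bullet> (snd p - fst p)} \<le> ennreal e'"
        using eventually_happens'[OF trivial_limit_at_right_real] by blast
      obtain \<gamma> where g: "\<gamma> \<in> couplings \<rho> \<mu>" and near: "tcost \<gamma> < OT \<rho> \<mu> + ennreal \<eta>"
        using OT_near_optimal_add[OF OT_finite[OF P mu] \<eta>(1)] .
      note s = couplingsD(2)[OF g, measurable_cong] and sp = couplingsD(3)[OF g]
      let ?S = "\<lambda>u. {p. fst p \<in> C \<and> r / D < u \<bullet> (snd p - fst p)}"
      have S: "?S u \<in> sets \<gamma>" for u
      proof -
        have "{p \<in> space \<gamma>. fst p \<in> C \<and> r / D < u \<bullet> (snd p - fst p)} \<in> sets \<gamma>" by measurable
        then show ?thesis by (simp add: sp)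
      qed
      have "emeasure \<rho> C = (\<integral>\<^sup>+p. indicator C (fst p) \<partial>\<gamma>)"
        using coupling_fst[OF g, of "indicator C"] P2D[OF P] by simp
      also have "\<dots> \<le> (\<integral>\<^sup>+p. indicator N (snd p) + (\<Sum>u\<in>U. indicator (?S u) p) \<partial>\<gamma>)"
      proof (rule nn_integral_mono)
        fix p
        show "(indicator C (fst p) :: ennreal) \<le> indicator N (snd p) + (\<Sum>u\<in>U. indicator (?S u) p)"
        proof (cases "fst p \<in> C \<and> snd p \<notin> N")
          case True
          have "r < infdist (snd p) C" using True by (simp add: N_def)
          also have "\<dots> \<le> dist (snd p) (fst p)" using True by (auto intro: infdist_le)
          also have "\<dots> \<le> (\<Sum>b\<in>Basis. \<bar>(snd p - fst p) \<bullet> b\<bar>)"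
            unfolding dist_norm by (rule norm_le_l1)
          finally have "r < (\<Sum>b\<in>Basis. \<bar>(snd p - fst p) \<bullet> b\<bar>)" .
          moreover have "(\<Sum>b\<in>(Basis::'a set). r / D) = r" using D by (simp add: D_def)
          ultimately obtain b where b: "b \<in> Basis" "r / D < \<bar>(snd p - fst p) \<bullet> b\<bar>"
            by (metis (no_types, lifting) linorder_not_le sum_mono)
          then have "p \<in> ?S b \<or> p \<in> ?S (- b)" "b \<in> U" "- b \<in> U"
            using True by (auto simp: U_def inner_commute abs_if split: if_splits)
          then obtain u where u: "u \<in> U" "p \<in> ?S u" by blast
          have "(1::ennreal) = indicator (?S u) p" using u by simp
          also have "\<dots> \<le> (\<Sum>u\<in>U. indicator (?S u) p)"
            using u U by (intro member_le_sum) auto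
          finally show ?thesis using True by simp
        qed (auto simp: indicator_def)
      qed
      also have "\<dots> = emeasure \<mu> N + (\<Sum>u\<in>U. emeasure \<gamma> (?S u))"
        using coupling_snd[OF g, of "indicator N"] P2D[OF mu] S
        by (simp add: nn_integral_add nn_integral_sum borel_measurable_indicator)
      also have "\<dots> \<le> emeasure \<mu> N + (\<Sum>u\<in>U. ennreal e')"
        using \<eta>(2)[OF _ g less_imp_le[OF near]] by (intro add_mono sum_mono) auto
      also have "(\<Sum>u\<in>U. ennreal e') = ennreal e"
        using U e' by (simp add: e'_def ennreal_of_nat_eq_real_of_nat ennreal_mult'[symmetric])
      finally show ?thesis .
    qed
    then show "emeasure \<rho> C \<le> emeasure \<mu> {y. infdist y C \<le> r}"
      unfolding N_def[symmetric] by (rule ennreal_le_epsilon)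
  qed (use P2D[OF mu] in auto)
qed simp

text \<open>Mass that reaches \<open>y \<in> B\<close> from outside \<open>B\<close> could instead start at \<open>y\<close> itself.\<close>

lemma minimizer_ge_submeasure_on_gap:
  fixes B :: "'a::euclidean_space set"
  assumes mu: "\<mu> \<in> P2" and min: "K2_minimizer \<mu> \<rho>"
    and B: "compact B" and d: "0 < d" "d \<le> 1"
    and N: "sets N = sets borel" "\<And>E. E \<in> sets borel \<Longrightarrow> emeasure N E \<le> emeasure \<mu> E" "emeasure N (- B) = 0"
    and gap: "\<And>E. E \<in> sets borel \<Longrightarrow> E \<subseteq> B \<Longrightarrow> emeasure \<rho> E + ennreal d * emeasure N E \<le> emeasure lborel E"
  shows "emeasure N B \<le> emeasure \<rho> B"
proof (cases "B = {}")
  case False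
  have K: "\<rho> \<in> K2" and P: "\<rho> \<in> P2" and opt: "\<And>\<sigma>. \<sigma> \<in> K2 \<Longrightarrow> OT \<rho> \<mu> \<le> OT \<sigma> \<mu>"
    using min by (auto simp: K2_minimizer_def K2_P2)
  have dom: "emeasure \<rho> E \<le> emeasure lborel E" if "E \<in> sets borel" for E
    using K that by (auto simp: K2_iff)
  note P2D(2)[OF P, measurable_cong] P2D(2)[OF mu, measurable_cong] N(1)[measurable_cong]
  have [measurable]: "B \<in> sets borel" using B by (simp add: compact_imp_closed)
  have Nnull: "emeasure N E = emeasure N (E \<inter> B)" if [measurable]: "E \<in> sets borel" for E
  proof -
    have "emeasure N (E - B) \<le> emeasure N (- B)" by (rule emeasure_mono) (auto simp: N(1))
    then have "emeasure N (E - B) = 0" using N(3) by simp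
    moreover have "emeasure N (E - B) + emeasure N (E \<inter> B) = emeasure N E"
      by (subst plus_emeasure) (auto simp: Un_Diff_Int N(1))
    ultimately show ?thesis by simp
  qed
  \<comment> \<open>\<open>k y\<close> is the share of the \<mu>-mass at \<open>y\<close> that
    belongs to \<open>N\<close>.\<close>
  obtain k :: "'a \<Rightarrow> real" where k0: "k \<in> borel_measurable \<mu>" "\<And>x. 0 \<le> k x" "\<And>x. k x \<le> 1"
      "N = density \<mu> (\<lambda>x. ennreal (k x))"
  proof (rule dominated_measure_density[of \<mu> N])
    show "sigma_finite_measure \<mu>" using P2D(1)[OF mu]
      by (simp add: prob_space.axioms(1) finite_measure.axioms(1))
    show "emeasure N (space N) < \<infinity>"
      using N(2)[of UNIV] P2D[OF mu] sets_eq_imp_space_eq[OF N(1)] by (auto intro: le_less_trans)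
  qed (use N P2D[OF mu] in auto)
  have [measurable]: "k \<in> borel_measurable borel" using k0(1) by simp
  have Nk: "emeasure N E = (\<integral>\<^sup>+x. ennreal (k x) * indicator E x \<partial>\<mu>)" if [measurable]: "E \<in> sets borel" for E
    unfolding k0(4) by (rule emeasure_density) auto
  show ?thesis
  proof (rule emeasure_le_of_thickenings[OF B _ _ _ False])
    fix r :: real assume r: "r > 0"
    define Br where "Br = {y. infdist y B \<le> r}"
    have [measurable]: "Br \<in> sets borel"
      unfolding Br_def by (rule borel_closed[OF closed_thickening])
    have "emeasure N B \<le> emeasure \<rho> Br + ennreal e" if e: "e > 0" for e
    proof -
      \<comment> \<open>Rerouted mass travels no distance, so each unit of \<open>N\<close>-mass
        reaching \<open>B\<close> from farther than \<open>r\<close> allows a saving of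
        \<open>d * r\<^sup>2\<close>. With this defect at most \<open>e\<close> such units
        remain.\<close>
      define \<eta> where "\<eta> = d * r\<^sup>2 * e"
      have \<eta>: "\<eta> > 0" using d r e by (simp add: \<eta>_def)
      obtain \<gamma> where g: "\<gamma> \<in> couplings \<rho> \<mu>" and near: "tcost \<gamma> < OT \<rho> \<mu> + ennreal \<eta>"
        using OT_near_optimal_add[OF OT_finite[OF P mu] \<eta>] .
      note s = couplingsD(2)[OF g, measurable_cong]
      \<comment> \<open>The factor \<open>d\<close> keeps the rerouted mass within the room that
        \<open>gap\<close> provides.\<close>
      define w where "w p = d * k (snd p) * indicator (- B) (fst p)" for p :: "'a \<times> 'a"
      have [measurable]: "w \<in> borel_measurable (borel \<Otimes>\<^sub>M borel)"
        unfolding w_def by measurable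
      have w: "0 \<le> w p" "w p \<le> 1" for p
        using d k0(2,3)[of "snd p"] by (auto simp: w_def indicator_def mult_le_one)
      have bound: "(\<integral>\<^sup>+p. ennreal (1 - w p) * indicator E (fst p) + ennreal (w p) * indicator E (snd p) \<partial>\<gamma>)
          \<le> emeasure lborel E" if [measurable]: "E \<in> sets borel" for E
      proof -
        have "(\<integral>\<^sup>+p. ennreal (1 - w p) * indicator E (fst p) + ennreal (w p) * indicator E (snd p) \<partial>\<gamma>)
          \<le> (\<integral>\<^sup>+p. indicator E (fst p) + ennreal d * (ennreal (k (snd p)) * indicator E (snd p)) \<partial>\<gamma>)"
        proof (intro nn_integral_mono add_mono)
          fix p
          show "ennreal (1 - w p) * indicator E (fst p) \<le> indicator E (fst p)"
            using w(1)[of p] by (auto simp: indicator_def ennreal_le_1)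
          have "ennreal (w p) \<le> ennreal d * ennreal (k (snd p))"
            using d k0(2)[of "snd p"] by (auto simp: w_def indicator_def ennreal_mult)
          then show "ennreal (w p) * indicator E (snd p) \<le> ennreal d * (ennreal (k (snd p)) * indicator E (snd p))"
            by (auto simp: indicator_def)
        qed
        also have "\<dots> = emeasure \<rho> E + ennreal d * emeasure N E"
          using coupling_fst[OF g, of "indicator E"] coupling_snd[OF g, of "\<lambda>y. ennreal (k y) * indicator E y"]
          by (simp add: nn_integral_add nn_integral_cmult Nk P2D[OF P])
        also have "emeasure N E = emeasure N (E \<inter> B)" by (rule Nnull) simp
        also have "emeasure \<rho> E = emeasure \<rho> (E - B) + emeasure \<rho> (E \<inter> B)"
          by (subst plus_emeasure) (auto simp: Un_Diff_Int P2D[OF P])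
        also have "emeasure \<rho> (E - B) + emeasure \<rho> (E \<inter> B) + ennreal d * emeasure N (E \<inter> B)
            \<le> emeasure lborel (E - B) + emeasure lborel (E \<inter> B)"
          unfolding add.assoc by (intro add_mono dom gap) auto
        also have "\<dots> = emeasure lborel E"
          by (subst plus_emeasure) (auto simp: Un_Diff_Int)
        finally show ?thesis .
      qed
      have ineq: "(\<integral>\<^sup>+p. ennreal (w p) * ennreal ((dist (fst p) (snd p))\<^sup>2) \<partial>\<gamma>)
          \<le> (\<integral>\<^sup>+p. ennreal (w p) * ennreal ((dist (snd p) (snd p))\<^sup>2) \<partial>\<gamma>) + ennreal \<eta>"
        by (rule replacement_inequality[OF mu g opt less_imp_le[OF near] tcost_finite[OF P mu g]])
          (use w bound in auto)
      then have ineq: "(\<integral>\<^sup>+p. ennreal (w p) * ennreal ((dist (fst p) (snd p))\<^sup>2) \<partial>\<gamma>) \<le> ennreal \<eta>"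
        by simp
      have "emeasure N B \<le> emeasure N UNIV" by (rule emeasure_mono) (auto simp: N(1))
      also have "\<dots> = (\<integral>\<^sup>+p. ennreal (k (snd p)) \<partial>\<gamma>)"
        using coupling_snd[OF g, of "\<lambda>y. ennreal (k y)"] by (simp add: Nk)
      \<comment> \<open>Pointwise split of the \<open>N\<close>-share of a pair: it starts in the
        thickening \<open>Br\<close>, or it reaches \<open>B\<close> from farther than
        \<open>r\<close> and is charged to the saved cost, or it ends off \<open>B\<close>, where
        \<open>N\<close> vanishes.\<close>
      also have "\<dots> \<le> (\<integral>\<^sup>+p. indicator Br (fst p) + (ennreal (1 / (d * r\<^sup>2)) *
          (ennreal (w p) * ennreal ((dist (fst p) (snd p))\<^sup>2)) + ennreal (k (snd p)) * indicator (- B) (snd p)) \<partial>\<gamma>)"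
      proof (rule nn_integral_mono)
        fix p
        show "ennreal (k (snd p)) \<le> indicator Br (fst p) + (ennreal (1 / (d * r\<^sup>2)) *
          (ennreal (w p) * ennreal ((dist (fst p) (snd p))\<^sup>2)) + ennreal (k (snd p)) * indicator (- B) (snd p))"
        proof (cases "snd p \<in> B \<and> fst p \<notin> Br")
          case True
          have "r < infdist (fst p) B" using True by (simp add: Br_def)
          also have "\<dots> \<le> dist (fst p) (snd p)" using True by (auto intro: infdist_le)
          finally have "r\<^sup>2 \<le> (dist (fst p) (snd p))\<^sup>2" using r by (intro power_mono) auto
          then have "k (snd p) * r\<^sup>2 \<le> k (snd p) * (dist (fst p) (snd p))\<^sup>2"
            using k0(2) by (intro mult_left_mono) auto
          then have "k (snd p) \<le> (1 / (d * r\<^sup>2)) * ((d * k (snd p)) * (dist (fst p) (snd p))\<^sup>2)"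
            using d r by (simp add: field_simps)
          moreover have "fst p \<notin> B" using True r by (auto simp: Br_def)
          ultimately have "ennreal (k (snd p)) \<le> ennreal ((1 / (d * r\<^sup>2)) * (w p * (dist (fst p) (snd p))\<^sup>2))"
            by (intro ennreal_leI) (simp add: w_def)
          also have "\<dots> = ennreal (1 / (d * r\<^sup>2)) * (ennreal (w p) * ennreal ((dist (fst p) (snd p))\<^sup>2))"
            using d r w by (simp add: ennreal_mult[symmetric] mult_nonneg_nonneg)
          finally show ?thesis using True by simp
        qed (use k0(3)[of "snd p"] in \<open>auto simp: indicator_def ennreal_le_1 intro: order.trans[of _ 1]\<close>)
      qed
      also have "\<dots> = emeasure \<rho> Br + (ennreal (1 / (d * r\<^sup>2)) *
          (\<integral>\<^sup>+p. ennreal (w p) * ennreal ((dist (fst p) (snd p))\<^sup>2) \<partial>\<gamma>) + emeasure N (- B))"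
        using coupling_fst[OF g, of "indicator Br"] coupling_snd[OF g, of "\<lambda>y. ennreal (k y) * indicator (- B) y"]
        by (simp add: nn_integral_add nn_integral_cmult Nk P2D[OF P])
      also have "\<dots> \<le> emeasure \<rho> Br + (ennreal (1 / (d * r\<^sup>2)) * ennreal \<eta> + 0)"
        using ineq N(3) by (intro add_mono mult_left_mono) auto
      also have "ennreal (1 / (d * r\<^sup>2)) * ennreal \<eta> + 0 = ennreal e"
        using d r e by (simp add: ennreal_mult'[symmetric] \<eta>_def)
      finally show ?thesis .
    qed
    then show "emeasure N B \<le> emeasure \<rho> {y. infdist y B \<le> r}"
      unfolding Br_def[symmetric] by (rule ennreal_le_epsilon)
  qed (use P2D[OF P] in auto)
qed simp

section \<open>Uniqueness of the minimizer\<close>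

text \<open>Passes from pointwise gaps between densities to the setwise slack conditions used above;
  the constant density 1 stands for Lebesgue measure.\<close>

lemma emeasure_density_add_le:
  fixes f g h :: "'a::euclidean_space \<Rightarrow> real"
  assumes [measurable]: "f \<in> borel_measurable borel" "g \<in> borel_measurable borel" "h \<in> borel_measurable borel" "E \<in> sets borel"
    and nn: "\<And>x. 0 \<le> f x" "\<And>x. 0 \<le> g x" "0 \<le> d"
    and le: "\<And>x. x \<in> E \<Longrightarrow> f x + d * g x \<le> h x"
  shows "emeasure (density lborel (\<lambda>x. ennreal (f x))) E + ennreal d * emeasure (density lborel (\<lambda>x. ennreal (g x))) E
    \<le> emeasure (density lborel (\<lambda>x. ennreal (h x))) E"
proof -
  have "emeasure (density lborel (\<lambda>x. ennreal (f x))) E + ennreal d * emeasure (density lborel (\<lambda>x. ennreal (g x))) E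
      = (\<integral>\<^sup>+x. ennreal (f x) * indicator E x + ennreal d * (ennreal (g x) * indicator E x) \<partial>lborel)"
    by (simp add: emeasure_density nn_integral_add nn_integral_cmult)
  also have "\<dots> \<le> (\<integral>\<^sup>+x. ennreal (h x) * indicator E x \<partial>lborel)"
  proof (rule nn_integral_mono)
    fix x
    show "ennreal (f x) * indicator E x + ennreal d * (ennreal (g x) * indicator E x) \<le> ennreal (h x) * indicator E x"
      using nn(1)[of x] nn(2)[of x] nn(3) le[of x]
      by (cases "x \<in> E") (auto simp: ennreal_mult'[symmetric] ennreal_plus[symmetric] intro!: ennreal_leI simp del: ennreal_plus)
  qed
  also have "\<dots> = emeasure (density lborel (\<lambda>x. ennreal (h x))) E"
    by (simp add: emeasure_density)
  finally show ?thesis .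
qed

text \<open>The contradiction is \<open>?F B + d * |B| \<le> ?M B = N B \<le> ?F B\<close> on a
  compact set \<open>B\<close> of positive Lebesgue measure \<open>|B|\<close>, with
  \<open>N\<close> the restriction of \<open>?M\<close> to \<open>B\<close>. Exchanging the two
  densities gives the other half of uniqueness.\<close>

lemma minimizer_density_le:
  fixes f0 f1 :: "'a::euclidean_space \<Rightarrow> real"
  assumes mu: "\<mu> \<in> P2"
    and [measurable]: "f0 \<in> borel_measurable borel" "f1 \<in> borel_measurable borel"
    and f: "\<And>x. 0 \<le> f0 x" "\<And>x. f0 x \<le> 1" "\<And>x. 0 \<le> f1 x" "\<And>x. f1 x \<le> 1"
    and min: "K2_minimizer \<mu> (density lborel (\<lambda>x. ennreal (f0 x)))" "K2_minimizer \<mu> (density lborel (\<lambda>x. ennreal (f1 x)))"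
  shows "AE x in lborel. f1 x \<le> f0 x"
proof (rule ccontr)
  assume contr: "\<not> (AE x in lborel. f1 x \<le> f0 x)"
  define m where "m x = (f0 x + f1 x) / 2" for x
  have [measurable]: "m \<in> borel_measurable borel" unfolding m_def by measurable
  let ?M = "density lborel (\<lambda>x. ennreal (m x))"
  let ?F = "density lborel (\<lambda>x. ennreal (f0 x))" and ?G = "density lborel (\<lambda>x. ennreal (f1 x))"
  have K: "?F \<in> K2" "?G \<in> K2" and same: "OT ?F \<mu> = OT ?G \<mu>"
    using min by (auto simp: K2_minimizer_def intro: antisym)
  have "OT ?F \<mu> < \<infinity>" by (rule OT_finite[OF K2_P2[OF K(1)] mu])
  then have mid: "?M \<in> K2" "OT ?M \<mu> \<le> OT ?F \<mu>"
    unfolding m_def using OT_midpoint_le[OF mu _ _ f(1,3) K, of "OT ?F \<mu>"] same by auto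
  then have minM: "K2_minimizer \<mu> ?M"
    using min(1) by (auto simp: K2_minimizer_def intro: order.trans)
  \<comment> \<open>The gap is twice the later \<open>d\<close>, so that on \<open>A n\<close> the
    midpoint is at least \<open>d\<close> above \<open>f0\<close> and at least \<open>d\<close>
    below \<open>f1\<close>, hence below 1.\<close>
  define A where "A n = {x. f0 x + 2 * (1 / real (Suc n)) \<le> f1 x}" for n
  have [measurable]: "A n \<in> sets borel" for n unfolding A_def by measurable
  have "\<exists>n. emeasure lborel (A n) \<noteq> 0"
  proof (rule ccontr)
    assume "\<nexists>n. emeasure lborel (A n) \<noteq> 0"
    then have "A n \<in> null_sets lborel" for n by (auto simp: null_sets_def)
    then have "(\<Union>n. A n) \<in> null_sets lborel" by auto
    then have "AE x in lborel. x \<notin> (\<Union>n. A n)" by (rule AE_not_in)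
    then have "AE x in lborel. f1 x \<le> f0 x"
    proof eventually_elim
      case (elim x)
      show ?case
      proof (rule ccontr)
        assume "\<not> f1 x \<le> f0 x"
        then obtain n where "inverse (real (Suc n)) < (f1 x - f0 x) / 2"
          using reals_Archimedean[of "(f1 x - f0 x) / 2"] by auto
        then have "x \<in> A n" by (simp add: A_def inverse_eq_divide)
        then show False using elim by blast
      qed
    qed
    then show False using contr by blast
  qed
  then obtain n where n: "emeasure lborel (A n) \<noteq> 0" by blast
  define d where "d = 1 / real (Suc n)"
  have d: "0 < d" "d \<le> 1" by (auto simp: d_def)
  have A: "f0 x + 2 * d \<le> f1 x" if "x \<in> A n" for x using that by (simp add: A_def d_def)
  have zero: "emeasure (density lborel (\<lambda>x. ennreal 0)) E = 0" for E :: "'a set"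
    by (cases "E \<in> sets borel") (simp_all add: emeasure_density emeasure_notin_sets)
  have "emeasure ?G (A n) \<noteq> 0"
  proof
    assume "emeasure ?G (A n) = 0"
    moreover have "emeasure (density lborel (\<lambda>x::'a. ennreal 0)) (A n) +
        ennreal d * emeasure (density lborel (\<lambda>x. ennreal 1)) (A n) \<le> emeasure ?G (A n)"
    proof (intro emeasure_density_add_le)
      fix x assume "x \<in> A n"
      then show "0 + d * 1 \<le> f1 x" using A[of x] f(1)[of x] d by linarith
    qed (use d f in auto)
    ultimately show False using n d by (simp add: zero density_1 del: ennreal_0)
  qed
  moreover have "emeasure ?G (A n) = (SUP K \<in> {K. K \<subseteq> A n \<and> compact K}. emeasure ?G K)"
    using P2D(5)[OF K2_P2[OF K(2)]] by (intro inner_regular) auto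
  ultimately obtain B where B: "B \<subseteq> A n" "compact B" "emeasure ?G B \<noteq> 0"
    by (metis (mono_tags, lifting) SUP_bot_conv(2) bot_ennreal mem_Collect_eq)
  have [measurable]: "B \<in> sets borel" using B by (simp add: compact_imp_closed)
  have lB: "emeasure lborel B \<noteq> 0"
    using B(3) K(2) by (metis K2_iff \<open>B \<in> sets borel\<close> le_zero_eq)
  \<comment> \<open>Uses the room \<open>d\<close> above \<open>m\<close>. The bound on compact sets
    is extended to all Borel subsets of \<open>B\<close> below, by inner regularity of
    \<open>?M\<close>.\<close>
  have mu_ge: "emeasure ?M C \<le> emeasure \<mu> C" if "compact C" "C \<subseteq> B" for C
  proof (rule minimizer_le_target_on_gap[OF mu minM that(1) d])
    fix E assume [measurable]: "E \<in> sets borel" and "E \<subseteq> C"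
    then have E: "f0 x + 2 * d \<le> f1 x" if "x \<in> E" for x using \<open>C \<subseteq> B\<close> B(1) A that by blast
    have "m x + d * 1 \<le> 1" if "x \<in> E" for x
      using E[OF that] f(4)[of x] unfolding m_def by argo
    then have "emeasure ?M E + ennreal d * emeasure (density lborel (\<lambda>x. ennreal 1)) E \<le> emeasure (density lborel (\<lambda>x. ennreal 1)) E"
      using d f by (intro emeasure_density_add_le) (auto simp: m_def)
    then show "emeasure ?M E + ennreal d * emeasure lborel E \<le> emeasure lborel E"
      by (simp add: density_1)
  qed
  define N where "N = density lborel (\<lambda>x. ennreal (m x * indicator B x))"
  have N: "emeasure N E = emeasure ?M (E \<inter> B)" if [measurable]: "E \<in> sets borel" for E
    unfolding N_def using f
    by (auto simp: emeasure_density indicator_def m_def intro!: nn_integral_cong)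
  have "emeasure N B = emeasure ?M B" by (simp add: N)
  moreover have "emeasure N B \<le> emeasure ?F B"
  proof (rule minimizer_ge_submeasure_on_gap[OF mu min(1) B(2) d])
    show "sets N = sets borel" by (simp add: N_def)
    show "emeasure N (- B) = 0" by (simp add: N)
    fix E :: "'a set" assume E[measurable]: "E \<in> sets borel"
    show "emeasure N E \<le> emeasure \<mu> E"
    proof -
      have "emeasure ?M (E \<inter> B) = (SUP K \<in> {K. K \<subseteq> E \<inter> B \<and> compact K}. emeasure ?M K)"
        using P2D(5)[OF K2_P2[OF mid(1)]] by (intro inner_regular) auto
      also have "\<dots> \<le> emeasure \<mu> E"
      proof (rule SUP_least)
        fix C assume "C \<in> {K. K \<subseteq> E \<inter> B \<and> compact K}"
        then have "emeasure ?M C \<le> emeasure \<mu> C" "C \<subseteq> E" using mu_ge by auto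
        then show "emeasure ?M C \<le> emeasure \<mu> E"
          using emeasure_mono[of C E \<mu>] E P2D(2)[OF mu] by (simp add: order.trans)
      qed
      finally show ?thesis by (simp add: N)
    qed
    assume "E \<subseteq> B"
    \<comment> \<open>As \<open>m\<close> is at most 1, adding \<open>d * m\<close> uses at most
      \<open>d\<close> of the gap between \<open>f0\<close> and \<open>f1\<close>.\<close>
    then have "f0 x + d * m x \<le> 1" if "x \<in> E" for x
    proof -
      have "f0 x + 2 * d \<le> f1 x" using \<open>E \<subseteq> B\<close> B(1) A that by blast
      moreover have "d * m x \<le> d" using d f[of x] by (auto simp: m_def mult_le_cancel_left1)
      ultimately show ?thesis using f(4)[of x] d by linarith
    qed
    then have "emeasure ?F E + ennreal d * emeasure ?M E \<le> emeasure (density lborel (\<lambda>x. ennreal 1)) E"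
      using d f by (intro emeasure_density_add_le) (auto simp: m_def)
    moreover have "E \<inter> B = E" using \<open>E \<subseteq> B\<close> by blast
    ultimately show "emeasure ?F E + ennreal d * emeasure N E \<le> emeasure lborel E"
      by (simp add: density_1 N)
  qed
  moreover have "emeasure ?F B + ennreal d * emeasure (density lborel (\<lambda>x. ennreal 1)) B \<le> emeasure ?M B"
  proof (intro emeasure_density_add_le)
    fix x assume "x \<in> B"
    then have "f0 x + 2 * d \<le> f1 x" using B(1) A by blast
    then show "f0 x + d * 1 \<le> m x" unfolding m_def by argo
  qed (use d f in auto)
  ultimately have "emeasure ?F B + ennreal d * emeasure (density lborel (\<lambda>x. ennreal 1)) B \<le> emeasure ?F B + 0"
    by (metis add.right_neutral order.trans)
  then have "emeasure ?F B + ennreal d * emeasure lborel B \<le> emeasure ?F B + 0"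
    by (simp only: ennreal_1 density_1)
  moreover have "emeasure ?F B < \<infinity>"
    using emeasure_space[of ?F B] P2D(4,5)[OF K2_P2[OF K(1)]] by (auto intro: le_less_trans)
  ultimately have "ennreal d * emeasure lborel B \<le> 0"
    unfolding ennreal_add_left_cancel_le by (auto simp: less_top)
  then show False using lB d by simp
qed

theorem K2_minimizer_unique:
  assumes mu: "\<mu> \<in> P2" and min: "K2_minimizer \<mu> \<rho>" "K2_minimizer \<mu> \<sigma>"
  shows "\<rho> = \<sigma>"
proof -
  have K: "\<rho> \<in> K2" "\<sigma> \<in> K2" using min by (auto simp: K2_minimizer_def)
  obtain f where f: "f \<in> borel_measurable borel" "\<And>x. 0 \<le> f x" "\<And>x. f x \<le> 1" "\<rho> = density lborel (\<lambda>x. ennreal (f x))"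
    using K2_density[OF K(1)] by metis
  obtain g where g: "g \<in> borel_measurable borel" "\<And>x. 0 \<le> g x" "\<And>x. g x \<le> 1" "\<sigma> = density lborel (\<lambda>x. ennreal (g x))"
    using K2_density[OF K(2)] by metis
  note fm = f(1)[measurable] g(1)[measurable]
  have "AE x in lborel. g x \<le> f x"
    using minimizer_density_le[OF mu f(1) g(1) f(2,3) g(2,3)] min f(4) g(4) by simp
  moreover have "AE x in lborel. f x \<le> g x"
    using minimizer_density_le[OF mu g(1) f(1) g(2,3) f(2,3)] min f(4) g(4) by simp
  ultimately have "AE x in lborel. ennreal (f x) = ennreal (g x)"
    by eventually_elim simp
  then show ?thesis
    unfolding f(4) g(4) by (intro density_cong) auto
qed

section \<open>Existence of the minimizer\<close>

text \<open>The uniform distribution on the unit cube is a witness; it makes the infimum of the cost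
  finite.\<close>

lemma K2_nonempty: "\<exists>\<rho>. \<rho> \<in> (K2 :: 'a::euclidean_space measure set)"
proof
  let ?Q = "cbox 0 One :: 'a set"
  let ?r = "density lborel (\<lambda>x. ennreal (indicator ?Q x)) :: 'a measure"
  have em: "emeasure ?r E = emeasure lborel (?Q \<inter> E)" if [measurable]: "E \<in> sets borel" for E
    by (simp add: emeasure_density ennreal_indicator indicator_inter_arith[symmetric])
  obtain b where b: "\<And>x. x \<in> ?Q \<Longrightarrow> norm x \<le> b"
    using bounded_cbox by (metis bounded_iff)
  have "(\<integral>\<^sup>+x. ennreal ((norm x)\<^sup>2) \<partial>?r) = (\<integral>\<^sup>+x. ennreal (indicator ?Q x) * ennreal ((norm x)\<^sup>2) \<partial>lborel)"
    by (subst nn_integral_density) auto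
  also have "\<dots> \<le> (\<integral>\<^sup>+x. ennreal (b\<^sup>2) * indicator ?Q x \<partial>lborel)"
    using b by (intro nn_integral_mono) (auto simp: indicator_def intro!: ennreal_leI power_mono)
  also have "\<dots> < \<infinity>"
    by (simp add: nn_integral_cmult_indicator ennreal_mult_less_top emeasure_lborel_cbox_eq)
  finally have "(\<integral>\<^sup>+x. ennreal ((norm x)\<^sup>2) \<partial>?r) < \<infinity>" .
  moreover have "emeasure ?r UNIV = 1"
    by (simp add: em emeasure_lborel_cbox_eq)
  ultimately have "?r \<in> P2" by (intro P2I) auto
  then show "?r \<in> K2"
    by (auto simp: K2_iff em intro!: emeasure_mono)
qed

text \<open>Picking near-minimizers of a strictly convex functional turns a sequence that is only weakly
  compact into one that converges almost everywhere, by the parallelogram identity.\<close>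

lemma midpoint_closed_AE_Cauchy_selection:
  fixes S :: "nat \<Rightarrow> ('a \<Rightarrow> real) set"
  assumes "sigma_finite_measure M"
    and dec: "\<And>n k. n \<le> k \<Longrightarrow> S k \<subseteq> S n" and ne: "\<And>n. S n \<noteq> {}"
    and meas: "\<And>n f. f \<in> S n \<Longrightarrow> f \<in> borel_measurable M"
    and range: "\<And>n f x. f \<in> S n \<Longrightarrow> 0 \<le> f x" "\<And>n f x. f \<in> S n \<Longrightarrow> f x \<le> 1"
    and mid: "\<And>n f g. f \<in> S n \<Longrightarrow> g \<in> S n \<Longrightarrow> (\<lambda>x. (f x + g x) / 2) \<in> S n"
  obtains g where "\<And>n. g n \<in> S n" "AE x in M. Cauchy (\<lambda>n. g n x)"
proof -
  interpret sigma_finite_measure M by fact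
  \<comment> \<open>Functions bounded by 1 need not be square integrable for a sigma-finite
    \<open>M\<close>. The weight makes \<Phi> finite, and its positivity lets it be divided out at
    the end.\<close>
  obtain w :: "'a \<Rightarrow> real" where w[measurable]: "w \<in> borel_measurable M"
    and w0: "\<And>x. w x > 0" and wi: "integrable M w"
    by (rule obtain_positive_integrable_function) blast
  define W where "W = (\<integral>x. w x \<partial>M)"
  have W: "W \<ge> 0" unfolding W_def using w0 by (intro integral_nonneg_AE) (auto simp: less_imp_le)
  define \<Phi> where "\<Phi> f = (\<integral>x. (f x)\<^sup>2 * w x \<partial>M)" for f :: "'a \<Rightarrow> real"
  have int: "integrable M (\<lambda>x. (f x)\<^sup>2 * w x)"
    if [measurable]: "f \<in> borel_measurable M" and b: "\<And>x. \<bar>f x\<bar> \<le> 1" for f :: "'a \<Rightarrow> real"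
  proof (rule Bochner_Integration.integrable_bound[OF wi])
    show "AE x in M. norm ((f x)\<^sup>2 * w x) \<le> norm (w x)"
    proof (rule AE_I2)
      fix x
      have "(f x)\<^sup>2 \<le> 1" using b[of x] by (simp add: abs_square_le_1)
      then show "norm ((f x)\<^sup>2 * w x) \<le> norm (w x)"
        using w0[of x] by (simp add: abs_mult mult_le_cancel_right1)
    qed
  qed measurable
  have Sint: "integrable M (\<lambda>x. (f x)\<^sup>2 * w x)" if "f \<in> S n" for f n
    using range[OF that] by (intro int meas[OF that]) (auto simp: abs_le_iff intro: order.trans[of _ 0])
  have \<Phi>0: "\<Phi> f \<ge> 0" for f
    unfolding \<Phi>_def using w0 by (intro integral_nonneg_AE) (auto simp: less_imp_le)
  have \<Phi>W: "\<Phi> f \<le> W" if "f \<in> S n" for f n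
    unfolding \<Phi>_def W_def
  proof (rule integral_mono[OF Sint[OF that] wi])
    fix x
    have "(f x)\<^sup>2 \<le> 1" using range[OF that, of x] by (simp add: power_le_one)
    then show "(f x)\<^sup>2 * w x \<le> w x" using w0[of x] by simp
  qed
  define d where "d n = Inf (\<Phi> ` S n)" for n
  have bdd: "bdd_below (\<Phi> ` S n)" for n using \<Phi>0 by (auto intro!: bdd_belowI[of _ 0])
  have d_le: "d n \<le> \<Phi> f" if "f \<in> S n" for f n
    unfolding d_def using that bdd by (auto intro: cInf_lower)
  have "incseq d"
    unfolding d_def by (auto simp: incseq_def ne intro!: cInf_superset_mono bdd image_mono dec)
  moreover have "d n \<le> W" for n using ne[of n] d_le \<Phi>W by (meson ex_in_conv order.trans)
  ultimately obtain L where L: "d \<longlonglongrightarrow> L" "\<And>n. d n \<le> L"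
    using incseq_convergent[of d W] by auto
  have "\<exists>f. f \<in> S n \<and> \<Phi> f < d n + 1 / real (Suc n)" for n
    using cInf_lessD[of "\<Phi> ` S n" "d n + 1 / real (Suc n)"] ne[of n] by (auto simp: d_def)
  then obtain f where f: "\<And>n. f n \<in> S n" "\<And>n. \<Phi> (f n) < d n + 1 / real (Suc n)"
    by metis
  note fm = meas[OF f(1), measurable]
  have fr: "\<bar>f i x - f j x\<bar> \<le> 1" for i j x
    using range[OF f(1), of i x] range[OF f(1), of j x] by linarith
  \<comment> \<open>The midpoint lies in \<open>S i\<close>, so its \<Phi> is at least
    \<open>d i\<close>, while \<Phi> of \<open>f i\<close> and \<open>f j\<close> is close to
    \<open>d i\<close> and \<open>d j\<close>. As \<open>d j\<close> is at most \<open>L\<close>,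
    the bound depends on \<open>i\<close> alone.\<close>
  have close: "(\<integral>x. (f i x - f j x)\<^sup>2 * w x \<partial>M) \<le> 2 * (L - d i) + 4 / real (Suc i)" if "i \<le> j" for i j
  proof -
    have fj: "f j \<in> S i" using f(1) dec[OF that] by blast
    let ?h = "\<lambda>x. (f i x + f j x) / 2"
    have h: "?h \<in> S i" by (rule mid[OF f(1) fj])
    have "(\<integral>x. (f i x - f j x)\<^sup>2 * w x \<partial>M) =
        (\<integral>x. 2 * ((f i x)\<^sup>2 * w x) + 2 * ((f j x)\<^sup>2 * w x) - 4 * ((?h x)\<^sup>2 * w x) \<partial>M)"
      by (intro Bochner_Integration.integral_cong refl) (simp add: power2_eq_square field_simps)
    also have "\<dots> = 2 * \<Phi> (f i) + 2 * \<Phi> (f j) - 4 * \<Phi> ?h"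
      unfolding \<Phi>_def using Sint[OF f(1)] Sint[OF h] by simp
    also have "\<dots> \<le> 2 * (d i + 1 / real (Suc i)) + 2 * (d j + 1 / real (Suc j)) - 4 * d i"
      using f(2)[of i] f(2)[of j] d_le[OF h] by (intro diff_mono add_mono mult_left_mono) auto
    also have "\<dots> \<le> 2 * (L - d i) + 4 / real (Suc i)"
      using L(2)[of j] frac_le[of 1 1 "real (Suc i)" "real (Suc j)"] that by simp
    finally show ?thesis .
  qed
  have "(\<lambda>i. 2 * (L - d i) + 4 / real (Suc i)) \<longlonglongrightarrow> 2 * (L - L) + 0"
    by (intro tendsto_intros L(1) LIMSEQ_Suc[OF lim_const_over_n])
  then have lim: "(\<lambda>i. 2 * (L - d i) + 4 / real (Suc i)) \<longlonglongrightarrow> 0" by simp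
  have "\<exists>N. \<forall>i\<ge>N. \<forall>j\<ge>N. (\<integral>x. norm (f i x * w x - f j x * w x) \<partial>M) < e" if e: "e > 0" for e
  proof -
    \<comment> \<open>The weighted first power is controlled by the square through
      \<open>a \<le> s + a\<^sup>2 / s\<close>; this \<open>s\<close> makes the first term integrate
      to less than \<open>e / 2\<close>.\<close>
    define s where "s = e / (2 * (W + 1))"
    have s: "s > 0" using e W by (simp add: s_def)
    have sW: "s * W < e / 2" using e W by (simp add: s_def field_simps)
    obtain N where N: "\<And>i. i \<ge> N \<Longrightarrow> 2 * (L - d i) + 4 / real (Suc i) < s * (e / 2)"
      using order_tendstoD(2)[OF lim, of "s * (e / 2)"] s e by (auto simp: eventually_sequentially)
    have *: "(\<integral>x. norm (f i x * w x - f j x * w x) \<partial>M) < e" if "N \<le> i" "i \<le> j" for i j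
    proof -
      have int2: "integrable M (\<lambda>x. (f i x - f j x)\<^sup>2 * w x)"
        using fr by (intro int) auto
      have "(\<integral>x. norm (f i x * w x - f j x * w x) \<partial>M) \<le> (\<integral>x. s * w x + (1 / s) * ((f i x - f j x)\<^sup>2 * w x) \<partial>M)"
      proof (rule integral_mono_AE')
        show "integrable M (\<lambda>x. s * w x + (1 / s) * ((f i x - f j x)\<^sup>2 * w x))"
          using wi int2 by simp
        show "AE x in M. norm (f i x * w x - f j x * w x) \<le> s * w x + (1 / s) * ((f i x - f j x)\<^sup>2 * w x)"
        proof (rule AE_I2)
          fix x
          define a where "a = \<bar>f i x - f j x\<bar>"
          have "a \<le> s + (1 / s) * a\<^sup>2"
          proof (cases "a \<le> s")
            case False
            then have "a * s \<le> a * a" using s by (intro mult_left_mono) auto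
            then have "a \<le> (1 / s) * a\<^sup>2" using s by (simp add: field_simps power2_eq_square)
            then show ?thesis using s by linarith
          qed (use s in \<open>simp add: add_increasing2\<close>)
          then have "a * w x \<le> (s + (1 / s) * a\<^sup>2) * w x"
            using w0[of x] by (intro mult_right_mono) auto
          moreover have "norm (f i x * w x - f j x * w x) = a * w x"
            using w0[of x] by (simp add: a_def left_diff_distrib[symmetric] abs_mult)
          ultimately show "norm (f i x * w x - f j x * w x) \<le> s * w x + (1 / s) * ((f i x - f j x)\<^sup>2 * w x)"
            by (simp add: a_def algebra_simps)
        qed
        show "AE x in M. 0 \<le> s * w x + (1 / s) * ((f i x - f j x)\<^sup>2 * w x)"
          using s w0 by (intro AE_I2 add_nonneg_nonneg mult_nonneg_nonneg) (auto simp: less_imp_le)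
      qed
      also have "\<dots> = s * W + (1 / s) * (\<integral>x. (f i x - f j x)\<^sup>2 * w x \<partial>M)"
        unfolding W_def using wi int2 by simp
      also have "\<dots> < e / 2 + (1 / s) * (s * (e / 2))"
        using close[OF that(2)] N[OF that(1)] sW s by (intro add_strict_mono mult_strict_left_mono) auto
      also have "\<dots> = e" using s by simp
      finally show ?thesis .
    qed
    show ?thesis
    proof (intro exI[of _ N] allI impI)
      fix i j assume "N \<le> i" "N \<le> j"
      moreover have "(\<integral>x. norm (f i x * w x - f j x * w x) \<partial>M) = (\<integral>x. norm (f j x * w x - f i x * w x) \<partial>M)"
        by (intro Bochner_Integration.integral_cong refl norm_minus_commute)
      ultimately show "(\<integral>x. norm (f i x * w x - f j x * w x) \<partial>M) < e"
        using *[of i j] *[of j i] by (metis nle_le)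
    qed
  qed
  then obtain r where r: "strict_mono r" "AE x in M. Cauchy (\<lambda>i. f (r i) x * w x)"
  proof (rule cauchy_L1_AE_cauchy_subseq[rotated])
    show "integrable M (\<lambda>x. f n x * w x)" for n
    proof (rule Bochner_Integration.integrable_bound[OF wi])
      show "AE x in M. norm (f n x * w x) \<le> norm (w x)"
        using range[OF f(1)[of n]] by (intro AE_I2) (simp add: abs_mult mult_left_le_one_le)
    qed measurable
  qed
  show thesis
  proof (rule that[of "\<lambda>n. f (r n)"])
    \<comment> \<open>A strictly increasing \<open>r\<close> satisfies \<open>n \<le> r n\<close>,
      so the subsequence stays in the decreasing sets at the original index.\<close>
    show "f (r n) \<in> S n" for n using f(1)[of "r n"] dec[OF seq_suble[OF r(1)]] by blast
    show "AE x in M. Cauchy (\<lambda>n. f (r n) x)"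
      using r(2)
    proof eventually_elim
      case (elim x)
      then have "convergent (\<lambda>i. f (r i) x * w x)" by (rule Cauchy_convergent)
      then have "convergent (\<lambda>i. f (r i) x * w x * inverse (w x))" by (rule convergent_mult) (rule convergent_const)
      moreover have "f (r i) x * w x * inverse (w x) = f (r i) x" for i
        using w0[of x] by (simp add: field_simps)
      ultimately have "convergent (\<lambda>i. f (r i) x)" by simp
      then show ?case by (rule convergent_Cauchy)
    qed
  qed
qed

section \<open>Transferring plans between densities\<close>

text \<open>The product measure divided by the common mass \<open>e\<close>. For
  \<open>e = 0\<close> the factor \<open>inverse e\<close> is infinite, but then all integrals
  vanish.\<close>

lemma finite_measure_plan_exists:
  fixes a b :: "'a::euclidean_space measure"
  assumes s: "sets a = sets borel" "sets b = sets borel"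
    and e: "emeasure a UNIV = e" "emeasure b UNIV = e" "e < \<infinity>"
  obtains R where "sets R = sets (borel \<Otimes>\<^sub>M borel)"
    "\<And>g. g \<in> borel_measurable borel \<Longrightarrow> (\<integral>\<^sup>+p. g (fst p) \<partial>R) = (\<integral>\<^sup>+x. g x \<partial>a)"
    "\<And>g. g \<in> borel_measurable borel \<Longrightarrow> (\<integral>\<^sup>+p. g (snd p) \<partial>R) = (\<integral>\<^sup>+x. g x \<partial>b)"
proof -
  note s[measurable_cong]
  have sp: "space a = UNIV" "space b = UNIV"
    using sets_eq_imp_space_eq[OF s(1)] sets_eq_imp_space_eq[OF s(2)] by simp_all
  interpret A: finite_measure a by (rule finite_measureI) (use e sp in auto)
  interpret B: finite_measure b by (rule finite_measureI) (use e sp in auto)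
  let ?R = "density (a \<Otimes>\<^sub>M b) (\<lambda>_. inverse e)"
  have null: "(\<integral>\<^sup>+x. g x \<partial>M) = 0" if "e = 0" "M = a \<or> M = b" for M and g :: "'a \<Rightarrow> ennreal"
  proof -
    have "UNIV \<in> null_sets M" using that e s by (auto simp: null_sets_def)
    then have "AE x in M. False" by (intro AE_I'[where N=UNIV]) auto
    then have "AE x in M. g x = 0" by eventually_elim simp
    then show ?thesis by (simp cong: nn_integral_cong_AE)
  qed
  have inv: "inverse e * (e * t) = t" if "e = 0 \<Longrightarrow> t = 0" for t :: ennreal
  proof (cases "e = 0")
    case False
    then have "inverse e * e = 1" using e(3) by (simp add: ennreal_inverse_mult mult.commute ennreal_divide_self divide_ennreal_def[symmetric])
    then show ?thesis by (simp add: mult.assoc[symmetric])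
  qed (use that in simp)
  show thesis
  proof (rule that[of ?R])
    show "sets ?R = sets (borel \<Otimes>\<^sub>M borel)" using s by (simp cong: sets_pair_measure_cong)
    fix g :: "'a \<Rightarrow> ennreal" assume [measurable]: "g \<in> borel_measurable borel"
    have "(\<integral>\<^sup>+p. g (fst p) \<partial>?R) = inverse e * (\<integral>\<^sup>+p. g (fst p) \<partial>(a \<Otimes>\<^sub>M b))"
      by (simp add: nn_integral_density nn_integral_cmult)
    also have "(\<integral>\<^sup>+p. g (fst p) \<partial>(a \<Otimes>\<^sub>M b)) = e * (\<integral>\<^sup>+x. g x \<partial>a)"
      by (subst B.nn_integral_fst[symmetric]) (auto simp: sp e nn_integral_cmult mult.commute)
    finally show "(\<integral>\<^sup>+p. g (fst p) \<partial>?R) = (\<integral>\<^sup>+x. g x \<partial>a)" using null by (simp add: inv)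
    have "(\<integral>\<^sup>+p. g (snd p) \<partial>?R) = inverse e * (\<integral>\<^sup>+p. g (snd p) \<partial>(a \<Otimes>\<^sub>M b))"
      by (simp add: nn_integral_density nn_integral_cmult)
    also have "(\<integral>\<^sup>+p. g (snd p) \<partial>(a \<Otimes>\<^sub>M b)) = e * (\<integral>\<^sup>+x. g x \<partial>b)"
      by (subst B.nn_integral_fst[symmetric]) (auto simp: sp e mult.commute)
    finally show "(\<integral>\<^sup>+p. g (snd p) \<partial>?R) = (\<integral>\<^sup>+x. g x \<partial>b)" using null by (simp add: inv)
  qed
qed

text \<open>The common part of the two densities is transported as in \<open>\<gamma>\<close>; the remainder of \<open>f\<close> is
  matched with what is left of \<open>\<mu>\<close> in an arbitrary way.\<close>

lemma OT_le_transfer: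
  fixes f g :: "'a::euclidean_space \<Rightarrow> real"
  assumes mu: "\<mu> \<in> P2"
    and [measurable]: "f \<in> borel_measurable borel" "g \<in> borel_measurable borel"
    and nn: "\<And>x. 0 \<le> f x" "\<And>x. 0 \<le> g x"
    and P: "density lborel (\<lambda>x. ennreal (f x)) \<in> P2" "density lborel (\<lambda>x. ennreal (g x)) \<in> P2"
    and coup: "\<gamma> \<in> couplings (density lborel (\<lambda>x. ennreal (g x))) \<mu>"
  shows "OT (density lborel (\<lambda>x. ennreal (f x))) \<mu> \<le> tcost \<gamma>
    + (2 * (\<integral>\<^sup>+x. ennreal ((norm x)\<^sup>2) * ennreal (f x - min (f x) (g x)) \<partial>lborel)
    + 2 * (ennreal (R\<^sup>2) * (\<integral>\<^sup>+x. ennreal (f x - min (f x) (g x)) \<partial>lborel)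
      + (\<integral>\<^sup>+y. ennreal ((norm y)\<^sup>2) * indicator {y. R < norm y} y \<partial>\<mu>)))"
proof -
  note couplingsD(2)[OF coup, measurable_cong]
  interpret \<gamma>: prob_space \<gamma> by (rule couplingsD[OF coup])
  let ?F = "density lborel (\<lambda>x. ennreal (f x))" and ?G = "density lborel (\<lambda>x. ennreal (g x))"
  define h where "h x = min (f x) (g x)" for x
  \<comment> \<open>The share of the \<gamma>-mass over \<open>x\<close> that is kept. Where
    \<open>g x = 0\<close> the quotient is 0 by convention, in agreement with
    \<open>h x = 0\<close>.\<close>
  define k where "k x = h x / g x" for x
  have [measurable]: "h \<in> borel_measurable borel" "k \<in> borel_measurable borel"
    unfolding h_def k_def by measurable
  have h: "0 \<le> h x" "h x \<le> f x" "h x \<le> g x" for x using nn[of x] by (auto simp: h_def)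
  have k: "0 \<le> k x" "k x \<le> 1" "g x * k x = h x" for x
    using h[of x] nn[of x] by (cases "g x = 0"; simp add: k_def)+
  have kint: "(\<integral>\<^sup>+p. ennreal (k (fst p)) * t (fst p) \<partial>\<gamma>) = (\<integral>\<^sup>+x. ennreal (h x) * t x \<partial>lborel)"
    if [measurable]: "t \<in> borel_measurable borel" for t :: "'a \<Rightarrow> ennreal"
  proof -
    have "(\<integral>\<^sup>+p. ennreal (k (fst p)) * t (fst p) \<partial>\<gamma>) = (\<integral>\<^sup>+x. ennreal (k x) * t x \<partial>?G)"
      using coupling_fst[OF coup, of "\<lambda>x. ennreal (k x) * t x"] by simp
    also have "\<dots> = (\<integral>\<^sup>+x. ennreal (g x) * (ennreal (k x) * t x) \<partial>lborel)"
      by (subst nn_integral_density) auto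
    also have "\<dots> = (\<integral>\<^sup>+x. ennreal (h x) * t x \<partial>lborel)"
      using k nn by (intro nn_integral_cong) (simp add: mult.assoc[symmetric] ennreal_mult[symmetric])
    finally show ?thesis .
  qed
  define a where "a = density lborel (\<lambda>x. ennreal (f x - h x))"
  define b where "b = distr (density \<gamma> (\<lambda>p. ennreal (1 - k (fst p)))) borel snd"
  have a_int: "(\<integral>\<^sup>+x. t x \<partial>a) = (\<integral>\<^sup>+x. ennreal (f x - h x) * t x \<partial>lborel)" if "t \<in> borel_measurable borel" for t
    unfolding a_def using that by (subst nn_integral_density) auto
  have b_int: "(\<integral>\<^sup>+y. t y \<partial>b) = (\<integral>\<^sup>+p. ennreal (1 - k (fst p)) * t (snd p) \<partial>\<gamma>)" if [measurable]: "t \<in> borel_measurable borel" for t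
    unfolding b_def by (simp add: nn_integral_distr nn_integral_density)
  have k1: "ennreal (k x) * t + ennreal (1 - k x) * t = t" for x t
    using k[of x] by (simp add: distrib_right[symmetric] ennreal_plus[symmetric] del: ennreal_plus)
  have h1: "ennreal (h x) * t + ennreal (f x - h x) * t = ennreal (f x) * t" for x t
    using h[of x] by (simp add: distrib_right[symmetric] ennreal_plus[symmetric] del: ennreal_plus)
  \<comment> \<open>Mass of the kept part. It is finite and completes each of the remainders
    \<open>a\<close> and \<open>b\<close> to mass 1, so these have equal mass and admit a
    plan.\<close>
  define H where "H = (\<integral>\<^sup>+x. ennreal (h x) \<partial>lborel)"
  have "H + emeasure a UNIV = (\<integral>\<^sup>+x. ennreal (f x) \<partial>lborel)"
    using h1[of _ 1] by (simp add: H_def a_def emeasure_density nn_integral_add[symmetric])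
  also have "\<dots> = 1" using P2D(5)[OF P(1)] by (simp add: emeasure_density)
  finally have Ha: "H + emeasure a UNIV = 1" .
  have "emeasure b UNIV = (\<integral>\<^sup>+p. ennreal (1 - k (fst p)) \<partial>\<gamma>)"
    using b_int[of "\<lambda>_. 1"] by (simp add: b_def)
  then have "H + emeasure b UNIV = (\<integral>\<^sup>+p. ennreal (k (fst p)) + ennreal (1 - k (fst p)) \<partial>\<gamma>)"
    using kint[of "\<lambda>_. 1"] by (simp add: H_def nn_integral_add)
  also have "\<dots> = 1" using k1[of _ 1] \<gamma>.emeasure_space_1 by simp
  finally have Hb: "H + emeasure b UNIV = 1" .
  have "H < \<infinity>" using Ha by (metis ennreal_add_eq_top ennreal_one_neq_top infinity_ennreal_def less_top)
  then have ab: "emeasure b UNIV = emeasure a UNIV"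
    using Ha Hb by (metis ennreal_add_left_cancel infinity_ennreal_def less_irrefl)
  have "emeasure a UNIV \<le> 1" using Ha by (metis add_increasing dual_order.refl zero_le)
  then have afin: "emeasure a UNIV < \<infinity>" by (auto intro: le_less_trans)
  obtain Q where Q: "sets Q = sets (borel \<Otimes>\<^sub>M borel)"
    "\<And>t. t \<in> borel_measurable borel \<Longrightarrow> (\<integral>\<^sup>+p. t (fst p) \<partial>Q) = (\<integral>\<^sup>+x. t x \<partial>a)"
    "\<And>t. t \<in> borel_measurable borel \<Longrightarrow> (\<integral>\<^sup>+p. t (snd p) \<partial>Q) = (\<integral>\<^sup>+x. t x \<partial>b)"
    using finite_measure_plan_exists[OF _ _ refl ab afin] by (auto simp: a_def b_def)
  note Q(1)[measurable_cong]
  define \<gamma>' where "\<gamma>' = add_measure (density \<gamma> (\<lambda>p. ennreal (k (fst p)))) Q"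
  have int: "(\<integral>\<^sup>+p. t p \<partial>\<gamma>') = (\<integral>\<^sup>+p. ennreal (k (fst p)) * t p \<partial>\<gamma>) + (\<integral>\<^sup>+p. t p \<partial>Q)"
    if [measurable]: "t \<in> borel_measurable (borel \<Otimes>\<^sub>M borel)" for t
    unfolding \<gamma>'_def
    by (simp add: nn_integral_add_measure couplingsD[OF coup] Q(1) nn_integral_density)
  have "\<gamma>' \<in> couplings ?F \<mu>"
  proof (rule couplingsI)
    show "sets \<gamma>' = sets (borel \<Otimes>\<^sub>M borel)" by (simp add: \<gamma>'_def couplingsD[OF coup])
    show "emeasure ?F UNIV = 1" by (rule P2D(5)[OF P(1)])
    show "sets \<mu> = sets borel" by (rule P2D[OF mu])
    fix E :: "'a set" assume E[measurable]: "E \<in> sets borel"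
    have "(\<integral>\<^sup>+p. indicator E (fst p) \<partial>\<gamma>') =
        (\<integral>\<^sup>+x. ennreal (h x) * indicator E x \<partial>lborel) + (\<integral>\<^sup>+x. ennreal (f x - h x) * indicator E x \<partial>lborel)"
      using kint[of "indicator E"] Q(2)[of "indicator E"] a_int[of "indicator E"] by (simp add: int)
    also have "\<dots> = (\<integral>\<^sup>+x. ennreal (f x) * indicator E x \<partial>lborel)"
      by (simp add: nn_integral_add[symmetric] h1)
    finally show "(\<integral>\<^sup>+p. indicator E (fst p) \<partial>\<gamma>') = emeasure ?F E"
      by (simp add: emeasure_density)
    have "(\<integral>\<^sup>+p. indicator E (snd p) \<partial>\<gamma>') =
        (\<integral>\<^sup>+p. ennreal (k (fst p)) * indicator E (snd p) \<partial>\<gamma>) + (\<integral>\<^sup>+p. ennreal (1 - k (fst p)) * indicator E (snd p) \<partial>\<gamma>)"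
      using Q(3)[of "indicator E"] b_int[of "indicator E"] by (simp add: int)
    also have "\<dots> = (\<integral>\<^sup>+p. indicator E (snd p) \<partial>\<gamma>)"
      by (simp add: nn_integral_add[symmetric] k1)
    finally show "(\<integral>\<^sup>+p. indicator E (snd p) \<partial>\<gamma>') = emeasure \<mu> E"
      using coupling_snd[OF coup, of "indicator E"] by (simp add: P2D[OF mu])
  qed simp
  then have "OT ?F \<mu> \<le> tcost \<gamma>'" by (rule OT_le_tcost)
  also have "\<dots> = (\<integral>\<^sup>+p. ennreal (k (fst p)) * ennreal ((dist (fst p) (snd p))\<^sup>2) \<partial>\<gamma>) + tcost Q"
    unfolding tcost_def by (rule int) measurable
  also have "\<dots> \<le> tcost \<gamma> + (2 * (\<integral>\<^sup>+x. ennreal ((norm x)\<^sup>2) \<partial>a) + 2 * (\<integral>\<^sup>+y. ennreal ((norm y)\<^sup>2) \<partial>b))"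
  proof (rule add_mono)
    show "(\<integral>\<^sup>+p. ennreal (k (fst p)) * ennreal ((dist (fst p) (snd p))\<^sup>2) \<partial>\<gamma>) \<le> tcost \<gamma>"
      unfolding tcost_def
    proof (rule nn_integral_mono)
      fix p :: "'a \<times> 'a"
      show "ennreal (k (fst p)) * ennreal ((dist (fst p) (snd p))\<^sup>2) \<le> ennreal ((dist (fst p) (snd p))\<^sup>2)"
        using mult_right_mono[of "ennreal (k (fst p))" 1] k(2)[of "fst p"] by simp
    qed
    show "tcost Q \<le> 2 * (\<integral>\<^sup>+x. ennreal ((norm x)\<^sup>2) \<partial>a) + 2 * (\<integral>\<^sup>+y. ennreal ((norm y)\<^sup>2) \<partial>b)"
      using tcost_le_moments[OF Q(1)] Q(2)[of "\<lambda>x. ennreal ((norm x)\<^sup>2)"] Q(3)[of "\<lambda>x. ennreal ((norm x)\<^sup>2)"]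
      by simp
  qed
  also have "(\<integral>\<^sup>+x. ennreal ((norm x)\<^sup>2) \<partial>a) = (\<integral>\<^sup>+x. ennreal ((norm x)\<^sup>2) * ennreal (f x - min (f x) (g x)) \<partial>lborel)"
    by (simp add: a_int h_def mult.commute)
  \<comment> \<open>The remainder \<open>b\<close> is dominated by \<mu> and has the mass of
    \<open>a\<close>. Up to radius \<open>R\<close> its moment is at most \<open>R\<^sup>2\<close>
    times that mass; beyond, it is at most the tail of \<mu>.\<close>
  also have "(\<integral>\<^sup>+y. ennreal ((norm y)\<^sup>2) \<partial>b) \<le> ennreal (R\<^sup>2) * (\<integral>\<^sup>+x. ennreal (f x - min (f x) (g x)) \<partial>lborel)
      + (\<integral>\<^sup>+y. ennreal ((norm y)\<^sup>2) * indicator {y. R < norm y} y \<partial>\<mu>)"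
  proof -
    have "(\<integral>\<^sup>+y. ennreal ((norm y)\<^sup>2) \<partial>b) \<le> (\<integral>\<^sup>+p. ennreal (R\<^sup>2) * ennreal (1 - k (fst p)) +
        ennreal ((norm (snd p))\<^sup>2) * indicator {y. R < norm y} (snd p) \<partial>\<gamma>)"
      unfolding b_int[of "\<lambda>y. ennreal ((norm y)\<^sup>2)", simplified]
    proof (rule nn_integral_mono)
      fix p :: "'a \<times> 'a"
      show "ennreal (1 - k (fst p)) * ennreal ((norm (snd p))\<^sup>2) \<le> ennreal (R\<^sup>2) * ennreal (1 - k (fst p)) +
        ennreal ((norm (snd p))\<^sup>2) * indicator {y. R < norm y} (snd p)"
      proof (cases "R < norm (snd p)")
        case True
        have "ennreal (1 - k (fst p)) * ennreal ((norm (snd p))\<^sup>2) \<le> 1 * ennreal ((norm (snd p))\<^sup>2)"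
          using k(1)[of "fst p"] by (intro mult_right_mono) (auto simp: ennreal_le_1)
        then show ?thesis using True by (simp add: add_increasing)
      next
        case False
        then have "(norm (snd p))\<^sup>2 \<le> R\<^sup>2" by (intro power_mono) auto
        then have "ennreal (1 - k (fst p)) * ennreal ((norm (snd p))\<^sup>2) \<le> ennreal (1 - k (fst p)) * ennreal (R\<^sup>2)"
          by (intro mult_left_mono ennreal_leI) auto
        then show ?thesis using False by (simp add: mult.commute)
      qed
    qed
    also have "\<dots> = ennreal (R\<^sup>2) * emeasure b UNIV + (\<integral>\<^sup>+y. ennreal ((norm y)\<^sup>2) * indicator {y. R < norm y} y \<partial>\<mu>)"
      using coupling_snd[OF coup, of "\<lambda>y. ennreal ((norm y)\<^sup>2) * indicator {y. R < norm y} y"] b_int[of "\<lambda>_. 1"]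
      by (simp add: nn_integral_add nn_integral_cmult b_def)
    also have "emeasure b UNIV = (\<integral>\<^sup>+x. ennreal (f x - min (f x) (g x)) \<partial>lborel)"
      unfolding ab by (simp add: a_def emeasure_density h_def)
    finally show ?thesis .
  qed
  finally show ?thesis by (simp add: add_mono mult_left_mono)
qed

section \<open>Almost everywhere limits: closedness of \<open>K2\<close> and lower
  semicontinuity\<close>

text \<open>Fatou's lemma for a bound that holds along the whole sequence.\<close>

lemma nn_integral_le_of_AE_LIMSEQ:
  fixes u :: "nat \<Rightarrow> 'a \<Rightarrow> ennreal"
  assumes [measurable]: "\<And>n. u n \<in> borel_measurable M"
    and lim: "AE x in M. (\<lambda>n. u n x) \<longlonglongrightarrow> v x" and le: "\<And>n. (\<integral>\<^sup>+x. u n x \<partial>M) \<le> c"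
  shows "(\<integral>\<^sup>+x. v x \<partial>M) \<le> c"
proof -
  have "AE x in M. v x = liminf (\<lambda>n. u n x)"
    using lim by eventually_elim (simp add: lim_imp_Liminf)
  then have "(\<integral>\<^sup>+x. v x \<partial>M) = (\<integral>\<^sup>+x. liminf (\<lambda>n. u n x) \<partial>M)"
    by (rule nn_integral_cong_AE)
  also have "\<dots> \<le> liminf (\<lambda>n. \<integral>\<^sup>+x. u n x \<partial>M)"
    by (rule nn_integral_liminf) measurable
  also have "\<dots> \<le> limsup (\<lambda>n. \<integral>\<^sup>+x. u n x \<partial>M)"
    by (rule Liminf_le_Limsup) simp
  also have "\<dots> \<le> c"
    using le by (intro Limsup_bounded) simp
  finally show ?thesis .
qed

text \<open>Fatou bounds the mass and the second moment of the limit from above. No mass escapes: by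
  Chebyshev the moment bound leaves little mass outside a large ball, uniformly in \<open>n\<close>,
  and inside the ball the densities are dominated by 1.\<close>

lemma K2_AE_limit:
  fixes f :: "nat \<Rightarrow> 'a::euclidean_space \<Rightarrow> real"
  assumes [measurable]: "\<And>n. f n \<in> borel_measurable borel" "g \<in> borel_measurable borel"
    and f: "\<And>n x. 0 \<le> f n x" "\<And>n x. f n x \<le> 1" and g: "\<And>x. 0 \<le> g x" "\<And>x. g x \<le> 1"
    and lim: "AE x in lborel. (\<lambda>n. f n x) \<longlonglongrightarrow> g x"
    and K: "\<And>n. density lborel (\<lambda>x. ennreal (f n x)) \<in> K2"
    and mom: "\<And>n. (\<integral>\<^sup>+x. ennreal ((norm x)\<^sup>2) \<partial>density lborel (\<lambda>x. ennreal (f n x))) \<le> M" "M < \<infinity>"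
  shows "density lborel (\<lambda>x. ennreal (g x)) \<in> K2"
proof -
  let ?G = "density lborel (\<lambda>x. ennreal (g x))"
  have mass: "(\<integral>\<^sup>+x. ennreal (f n x) \<partial>lborel) = 1" for n
    using P2D(5)[OF K2_P2[OF K[of n]]] by (simp add: emeasure_density)
  have mom': "(\<integral>\<^sup>+x. ennreal (f n x) * ennreal ((norm x)\<^sup>2) \<partial>lborel) \<le> M" for n
    using mom(1)[of n] by (simp add: nn_integral_density)
  have "(\<integral>\<^sup>+x. ennreal (g x) * ennreal ((norm x)\<^sup>2) \<partial>lborel) \<le> M"
  proof (rule nn_integral_le_of_AE_LIMSEQ[OF _ _ mom'])
    show "AE x in lborel. (\<lambda>n. ennreal (f n x) * ennreal ((norm x)\<^sup>2)) \<longlonglongrightarrow> ennreal (g x) * ennreal ((norm x)\<^sup>2)"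
      using lim
    proof eventually_elim
      case (elim x)
      then show ?case
        using f(1) g(1) by (simp add: ennreal_mult[symmetric] tendsto_ennrealI tendsto_mult)
    qed
  qed measurable
  then have "(\<integral>\<^sup>+x. ennreal ((norm x)\<^sup>2) \<partial>?G) \<le> M"
    by (simp add: nn_integral_density)
  then have momG: "(\<integral>\<^sup>+x. ennreal ((norm x)\<^sup>2) \<partial>?G) < \<infinity>"
    using mom(2) by (rule le_less_trans)
  have le1: "(\<integral>\<^sup>+x. ennreal (g x) \<partial>lborel) \<le> 1"
  proof (rule nn_integral_le_of_AE_LIMSEQ)
    show "AE x in lborel. (\<lambda>n. ennreal (f n x)) \<longlonglongrightarrow> ennreal (g x)"
      using lim by eventually_elim (rule tendsto_ennrealI)
  qed (simp_all add: mass)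
  have ge1: "1 \<le> (\<integral>\<^sup>+x. ennreal (g x) \<partial>lborel)"
  proof (rule ennreal_le_epsilon)
    fix e :: real assume e: "e > 0"
    obtain m where m: "M = ennreal m" "m \<ge> 0" using mom(2) by (cases M) auto
    \<comment> \<open>Gives \<open>m \<le> e * R\<close>, and the summand 1 ensures
      \<open>R \<le> R\<^sup>2\<close>; so \<open>m / R\<^sup>2\<close>, the Chebyshev bound for the
      mass outside the ball, is at most \<open>e\<close>.\<close>
    define R where "R = m / e + 1"
    have R: "R \<ge> 1" using m e by (simp add: R_def)
    have "m \<le> e * R" using e by (simp add: R_def field_simps)
    also have "\<dots> \<le> e * R\<^sup>2" using R e by (intro mult_left_mono) (auto simp: power2_eq_square)
    finally have mR: "m / R\<^sup>2 \<le> e" using R by (simp add: field_simps)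
    let ?B = "cball 0 R :: 'a set"
    have [measurable]: "?B \<in> sets borel" by simp
    have "1 \<le> (\<integral>\<^sup>+x. ennreal (f n x) * indicator ?B x \<partial>lborel) + ennreal e" for n
    proof -
      have "1 \<le> (\<integral>\<^sup>+x. ennreal (f n x) * indicator ?B x
          + ennreal (1 / R\<^sup>2) * (ennreal (f n x) * ennreal ((norm x)\<^sup>2)) \<partial>lborel)"
        unfolding mass[of n, symmetric]
      proof (rule nn_integral_mono)
        fix x :: 'a
        show "ennreal (f n x) \<le> ennreal (f n x) * indicator ?B x
          + ennreal (1 / R\<^sup>2) * (ennreal (f n x) * ennreal ((norm x)\<^sup>2))"
        proof (cases "x \<in> ?B")
          case False
          then have "R\<^sup>2 \<le> (norm x)\<^sup>2" using R by (intro power_mono) auto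
          then have "f n x * R\<^sup>2 \<le> f n x * (norm x)\<^sup>2" using f by (intro mult_left_mono) auto
          then have "f n x \<le> (1 / R\<^sup>2) * (f n x * (norm x)\<^sup>2)" using R by (simp add: field_simps)
          then have "ennreal (f n x) \<le> ennreal ((1 / R\<^sup>2) * (f n x * (norm x)\<^sup>2))" by (rule ennreal_leI)
          also have "\<dots> = ennreal (1 / R\<^sup>2) * (ennreal (f n x) * ennreal ((norm x)\<^sup>2))"
            using f(1)[of n x] by (simp add: ennreal_mult[symmetric])
          finally show ?thesis by (simp add: add_increasing)
        qed simp
      qed
      also have "\<dots> = (\<integral>\<^sup>+x. ennreal (f n x) * indicator ?B x \<partial>lborel)
          + ennreal (1 / R\<^sup>2) * (\<integral>\<^sup>+x. ennreal (f n x) * ennreal ((norm x)\<^sup>2) \<partial>lborel)"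
        by (subst nn_integral_add, measurable, subst nn_integral_cmult, measurable)
      also have "\<dots> \<le> (\<integral>\<^sup>+x. ennreal (f n x) * indicator ?B x \<partial>lborel) + ennreal (1 / R\<^sup>2) * M"
        by (intro add_left_mono mult_left_mono mom') simp
      also have "ennreal (1 / R\<^sup>2) * M \<le> ennreal e"
        using mR m by (simp add: ennreal_mult'[symmetric] ennreal_leI)
      finally show ?thesis by (simp add: add_left_mono)
    qed
    moreover have "(\<lambda>n. (\<integral>\<^sup>+x. ennreal (f n x) * indicator ?B x \<partial>lborel) + ennreal e)
        \<longlonglongrightarrow> (\<integral>\<^sup>+x. ennreal (g x) * indicator ?B x \<partial>lborel) + ennreal e"
    proof (intro tendsto_add tendsto_const nn_integral_dominated_convergence)
      show "(\<integral>\<^sup>+x. indicator ?B x \<partial>lborel) < \<infinity>"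
        using emeasure_lborel_cball_finite[of "0::'a" R] by (simp add: less_top)
      show "AE x in lborel. ennreal (f n x) * indicator ?B x \<le> indicator ?B x" for n
        using f by (auto simp: indicator_def ennreal_le_1)
      show "AE x in lborel. (\<lambda>n. ennreal (f n x) * indicator ?B x) \<longlonglongrightarrow> ennreal (g x) * indicator ?B x"
        using lim by eventually_elim (auto simp: indicator_def intro: tendsto_ennrealI)
    qed measurable
    ultimately have "1 \<le> (\<integral>\<^sup>+x. ennreal (g x) * indicator ?B x \<partial>lborel) + ennreal e"
      by (intro LIMSEQ_le_const) auto
    also have "\<dots> \<le> (\<integral>\<^sup>+x. ennreal (g x) \<partial>lborel) + ennreal e"
      by (intro add_right_mono nn_integral_mono) (auto simp: indicator_def)
    finally show "1 \<le> (\<integral>\<^sup>+x. ennreal (g x) \<partial>lborel) + ennreal e" .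
  qed
  have "emeasure ?G UNIV = 1"
    using le1 ge1 by (simp add: emeasure_density)
  then have "?G \<in> P2" using momG by (intro P2I) auto
  moreover have "emeasure ?G E \<le> emeasure lborel E" if [measurable]: "E \<in> sets borel" for E
  proof -
    have "emeasure ?G E = (\<integral>\<^sup>+x. ennreal (g x) * indicator E x \<partial>lborel)" by (simp add: emeasure_density)
    also have "\<dots> \<le> (\<integral>\<^sup>+x. indicator E x \<partial>lborel)"
      using g by (intro nn_integral_mono) (auto simp: indicator_def ennreal_le_1)
    finally show ?thesis by simp
  qed
  ultimately show ?thesis by (simp add: K2_iff)
qed

text \<open>A nearly optimal plan for \<open>f n\<close> is transferred to \<open>g\<close>. For a
  fixed radius \<open>j\<close> the mass and the moment of \<open>g - min g (f n)\<close> vanish as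
  \<open>n\<close> grows, both being dominated by those of \<open>g\<close>; only afterwards does
  \<open>j\<close> grow, to remove the tail \<open>Z j\<close> of \<mu>.\<close>

lemma OT_AE_limit_le:
  fixes f :: "nat \<Rightarrow> 'a::euclidean_space \<Rightarrow> real"
  assumes mu: "\<mu> \<in> P2"
    and [measurable]: "\<And>n. f n \<in> borel_measurable borel" "g \<in> borel_measurable borel"
    and f: "\<And>n x. 0 \<le> f n x" and g: "\<And>x. 0 \<le> g x"
    and lim: "AE x in lborel. (\<lambda>n. f n x) \<longlonglongrightarrow> g x"
    and P: "\<And>n. density lborel (\<lambda>x. ennreal (f n x)) \<in> P2" "density lborel (\<lambda>x. ennreal (g x)) \<in> P2"
    and OT: "\<And>n. OT (density lborel (\<lambda>x. ennreal (f n x))) \<mu> \<le> m + ennreal (1 / real (Suc n))"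
  shows "OT (density lborel (\<lambda>x. ennreal (g x))) \<mu> \<le> m"
proof -
  let ?G = "density lborel (\<lambda>x. ennreal (g x))"
  note P2D(2)[OF mu, measurable_cong]
  define X where "X n = (\<integral>\<^sup>+x. ennreal ((norm x)\<^sup>2) * ennreal (g x - min (g x) (f n x)) \<partial>lborel)" for n
  define Y where "Y n = (\<integral>\<^sup>+x. ennreal (g x - min (g x) (f n x)) \<partial>lborel)" for n
  define Z where "Z j = (\<integral>\<^sup>+y. ennreal ((norm y)\<^sup>2) * indicator {y. real j < norm y} y \<partial>\<mu>)" for j
  have diff: "AE x in lborel. (\<lambda>n. ennreal (g x - min (g x) (f n x))) \<longlonglongrightarrow> 0"
    using lim
  proof eventually_elim
    case (elim x)
    then have "(\<lambda>n. ennreal (g x - min (g x) (f n x))) \<longlonglongrightarrow> ennreal (g x - min (g x) (g x))"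
      by (intro tendsto_ennrealI tendsto_intros)
    then show ?case by simp
  qed
  have le_g: "ennreal (g x - min (g x) (f n x)) \<le> ennreal (g x)" for x n
    using f[of n x] g[of x] by (intro ennreal_leI) auto
  have "Y \<longlonglongrightarrow> (\<integral>\<^sup>+x. 0 \<partial>(lborel :: 'a measure))"
    unfolding Y_def
  proof (rule nn_integral_dominated_convergence)
    show "(\<integral>\<^sup>+x. ennreal (g x) \<partial>lborel) < \<infinity>"
      using P2D(5)[OF P(2)] by (simp add: emeasure_density)
  qed (use diff le_g in auto)
  then have Y: "Y \<longlonglongrightarrow> 0" by simp
  have "X \<longlonglongrightarrow> (\<integral>\<^sup>+x. 0 \<partial>(lborel :: 'a measure))"
    unfolding X_def
  proof (rule nn_integral_dominated_convergence)
    show "(\<integral>\<^sup>+x. ennreal ((norm x)\<^sup>2) * ennreal (g x) \<partial>lborel) < \<infinity>"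
      using P2_second_moment_finite[OF P(2)] by (simp add: nn_integral_density mult.commute)
    show "AE x in lborel. (\<lambda>n. ennreal ((norm x)\<^sup>2) * ennreal (g x - min (g x) (f n x))) \<longlonglongrightarrow> 0"
      using diff
    proof eventually_elim
      case (elim x)
      from ennreal_tendsto_cmult[OF _ this, of "ennreal ((norm x)\<^sup>2)"] show ?case by simp
    qed
    show "AE x in lborel. ennreal ((norm x)\<^sup>2) * ennreal (g x - min (g x) (f n x)) \<le> ennreal ((norm x)\<^sup>2) * ennreal (g x)" for n
      by (intro AE_I2 mult_left_mono le_g) simp
  qed measurable
  then have X: "X \<longlonglongrightarrow> 0" by simp
  have "Z \<longlonglongrightarrow> (\<integral>\<^sup>+y. 0 \<partial>\<mu>)"
    unfolding Z_def
  proof (rule nn_integral_dominated_convergence)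
    show "(\<integral>\<^sup>+y. ennreal ((norm y)\<^sup>2) \<partial>\<mu>) < \<infinity>" by (rule P2_second_moment_finite[OF mu])
    show "AE y in \<mu>. (\<lambda>j. ennreal ((norm y)\<^sup>2) * indicator {y. real j < norm y} y) \<longlonglongrightarrow> 0"
    proof (intro AE_I2 tendsto_eventually)
      fix y :: 'a
      obtain N :: nat where "norm y \<le> real N" using real_arch_simple by blast
      then show "\<forall>\<^sub>F j in sequentially. ennreal ((norm y)\<^sup>2) * indicator {y. real j < norm y} y = 0"
        unfolding eventually_sequentially by (intro exI[of _ N]) (auto simp: indicator_def)
    qed
  qed (auto simp: indicator_def)
  then have Z: "Z \<longlonglongrightarrow> 0" by simp
  have step: "OT ?G \<mu> \<le> m + 2 * Z j" for j
  proof -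
    \<comment> \<open>The error \<open>2 / (n + 1)\<close> combines that of \<open>f n\<close> as a
      near-minimizer with that of \<gamma> as a nearly optimal plan.\<close>
    have "OT ?G \<mu> \<le> (m + ennreal (2 / real (Suc n))) + (2 * X n + 2 * (ennreal ((real j)\<^sup>2) * Y n + Z j))" for n
    proof -
      have "1 / real (Suc n) > 0" by simp
      from OT_near_optimal_add[OF OT_finite[OF P(1) mu] this, of n]
      obtain \<gamma> where \<gamma>: "\<gamma> \<in> couplings (density lborel (\<lambda>x. ennreal (f n x))) \<mu>"
        "tcost \<gamma> < OT (density lborel (\<lambda>x. ennreal (f n x))) \<mu> + ennreal (1 / real (Suc n))" .
      have "tcost \<gamma> \<le> OT (density lborel (\<lambda>x. ennreal (f n x))) \<mu> + ennreal (1 / real (Suc n))"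
        using \<gamma>(2) by simp
      also have "\<dots> \<le> (m + ennreal (1 / real (Suc n))) + ennreal (1 / real (Suc n))"
        by (intro add_right_mono OT)
      also have "\<dots> = m + ennreal (2 / real (Suc n))"
        unfolding add.assoc by (subst ennreal_plus[symmetric]) (auto simp: add_divide_distrib[symmetric] simp del: of_nat_Suc)
      finally have "tcost \<gamma> \<le> m + ennreal (2 / real (Suc n))" .
      then show ?thesis
        using OT_le_transfer[OF mu _ _ g f P(2,1) \<gamma>(1), of "real j"]
        unfolding X_def Y_def Z_def by (auto intro: order.trans add_right_mono)
    qed
    moreover have "(\<lambda>n. (m + ennreal (2 / real (Suc n))) + (2 * X n + 2 * (ennreal ((real j)\<^sup>2) * Y n + Z j)))
        \<longlonglongrightarrow> (m + ennreal 0) + (2 * 0 + 2 * (ennreal ((real j)\<^sup>2) * 0 + Z j))"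
      by (intro tendsto_add tendsto_const ennreal_tendsto_cmult tendsto_ennrealI X Y LIMSEQ_Suc[OF lim_const_over_n]) auto
    ultimately have "OT ?G \<mu> \<le> (m + ennreal 0) + (2 * 0 + 2 * (ennreal ((real j)\<^sup>2) * 0 + Z j))"
      by (intro LIMSEQ_le_const) auto
    then show ?thesis by simp
  qed
  have "(\<lambda>j. m + 2 * Z j) \<longlonglongrightarrow> m + 2 * 0"
    by (intro tendsto_add tendsto_const ennreal_tendsto_cmult Z) auto
  then have "OT ?G \<mu> \<le> m + 2 * 0"
    using step by (intro LIMSEQ_le_const) auto
  then show ?thesis by simp
qed

theorem K2_minimizer_exists:
  fixes \<mu> :: "'a::euclidean_space measure"
  assumes mu: "\<mu> \<in> P2"
  shows "\<exists>\<rho>. K2_minimizer \<mu> \<rho>"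
proof -
  define m where "m = (INF \<sigma>\<in>K2. OT \<sigma> \<mu>)"
  have m_le: "m \<le> OT \<sigma> \<mu>" if "\<sigma> \<in> K2" for \<sigma> unfolding m_def using that by (rule INF_lower)
  obtain \<sigma>0 :: "'a measure" where "\<sigma>0 \<in> K2" using K2_nonempty by blast
  then have m: "m < \<infinity>" using m_le[of \<sigma>0] OT_finite[OF K2_P2 mu, of \<sigma>0] by (auto intro: le_less_trans)
  define S where "S n = {f. f \<in> borel_measurable borel \<and> (\<forall>x. 0 \<le> f x \<and> f x \<le> 1) \<and>
    density lborel (\<lambda>x. ennreal (f x)) \<in> K2 \<and>
    OT (density lborel (\<lambda>x. ennreal (f x))) \<mu> \<le> m + ennreal (1 / real (Suc n))}" for n
  obtain f where f: "\<And>n. f n \<in> S n" "AE x in lborel. Cauchy (\<lambda>n. f n x)"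
  proof (rule midpoint_closed_AE_Cauchy_selection[of lborel S])
    show "S k \<subseteq> S n" if "n \<le> k" for n k
    proof -
      have "ennreal (1 / real (Suc k)) \<le> ennreal (1 / real (Suc n))"
        using that by (intro ennreal_leI) (simp add: frac_le)
      then have "m + ennreal (1 / real (Suc k)) \<le> m + ennreal (1 / real (Suc n))" by (rule add_left_mono)
      then show ?thesis unfolding S_def by (auto intro: order.trans)
    qed
    show "S n \<noteq> {}" for n
    proof -
      obtain r where "m = ennreal r" "0 \<le> r" using m by (cases m) auto
      then have "m < m + ennreal (1 / real (Suc n))"
        by (simp add: ennreal_plus[symmetric] ennreal_less_iff del: ennreal_plus)
      then obtain \<sigma> where \<sigma>: "\<sigma> \<in> K2" "OT \<sigma> \<mu> < m + ennreal (1 / real (Suc n))"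
        unfolding m_def INF_less_iff by blast
      obtain h where "h \<in> borel_measurable borel" "\<And>x. 0 \<le> h x" "\<And>x. h x \<le> 1" "\<sigma> = density lborel (\<lambda>x. ennreal (h x))"
        using K2_density[OF \<sigma>(1)] by metis
      then have "h \<in> S n" using \<sigma> by (auto simp: S_def less_imp_le)
      then show ?thesis by blast
    qed
    show "(\<lambda>x. (f x + g x) / 2) \<in> S n" if "f \<in> S n" "g \<in> S n" for f g n
    proof -
      have f: "f \<in> borel_measurable borel" "\<And>x. 0 \<le> f x" "\<And>x. f x \<le> 1" "density lborel (\<lambda>x. ennreal (f x)) \<in> K2"
        "OT (density lborel (\<lambda>x. ennreal (f x))) \<mu> \<le> m + ennreal (1 / real (Suc n))"
        using that(1) by (auto simp: S_def)
      have g: "g \<in> borel_measurable borel" "\<And>x. 0 \<le> g x" "\<And>x. g x \<le> 1" "density lborel (\<lambda>x. ennreal (g x)) \<in> K2"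
        "OT (density lborel (\<lambda>x. ennreal (g x))) \<mu> \<le> m + ennreal (1 / real (Suc n))"
        using that(2) by (auto simp: S_def)
      have "m + ennreal (1 / real (Suc n)) < \<infinity>" using m by (simp add: less_top)
      note mid = OT_midpoint_le[OF mu f(1) g(1) f(2) g(2) f(4) g(4) f(5) g(5) this]
      have "f x + g x \<le> 2" for x using f(3)[of x] g(3)[of x] by linarith
      then show ?thesis using mid f(1,2) g(1,2) by (auto simp: S_def)
    qed
  qed (auto simp: S_def sigma_finite_lborel)
  have fS: "f n \<in> borel_measurable borel" "0 \<le> f n x" "f n x \<le> 1" "density lborel (\<lambda>x. ennreal (f n x)) \<in> K2"
    "OT (density lborel (\<lambda>x. ennreal (f n x))) \<mu> \<le> m + ennreal (1 / real (Suc n))" for n x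
    using f(1)[of n] by (auto simp: S_def)
  note fS(1)[measurable]
  \<comment> \<open>Clamping gives the bounds also at points where the sequence diverges and
    \<open>lim\<close> is unspecified; elsewhere it changes nothing.\<close>
  define g where "g x = max 0 (min 1 (lim (\<lambda>n. f n x)))" for x
  have [measurable]: "g \<in> borel_measurable borel" unfolding g_def by measurable
  have g: "0 \<le> g x" "g x \<le> 1" for x by (auto simp: g_def)
  have lim: "AE x in lborel. (\<lambda>n. f n x) \<longlonglongrightarrow> g x"
    using f(2)
  proof eventually_elim
    case (elim x)
    then have *: "(\<lambda>n. f n x) \<longlonglongrightarrow> lim (\<lambda>n. f n x)"
      by (simp add: Cauchy_convergent convergent_LIMSEQ_iff[symmetric])
    have "0 \<le> lim (\<lambda>n. f n x)" "lim (\<lambda>n. f n x) \<le> 1"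
      using fS(2,3) by (auto intro!: LIMSEQ_le_const[OF *] LIMSEQ_le_const2[OF *])
    then show ?case using * by (simp add: g_def)
  qed
  let ?G = "density lborel (\<lambda>x. ennreal (g x))"
  \<comment> \<open>In \<open>m + 2\<close> one unit covers the near-minimality error, at most 1 for
    every \<open>n\<close>, and one the excess cost of the chosen plan.\<close>
  define B where "B = 2 * (m + 2) + 2 * (\<integral>\<^sup>+x. ennreal ((norm x)\<^sup>2) \<partial>\<mu>)"
  have B: "B < \<infinity>" unfolding B_def
    using m P2_second_moment_finite[OF mu] by (simp add: ennreal_mult_less_top less_top)
  have mom: "(\<integral>\<^sup>+x. ennreal ((norm x)\<^sup>2) \<partial>density lborel (\<lambda>x. ennreal (f n x))) \<le> B" for n
  proof -
    obtain \<gamma> where \<gamma>: "\<gamma> \<in> couplings (density lborel (\<lambda>x. ennreal (f n x))) \<mu>"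
      "tcost \<gamma> < OT (density lborel (\<lambda>x. ennreal (f n x))) \<mu> + ennreal 1"
      using OT_near_optimal_add[OF OT_finite[OF K2_P2[OF fS(4)] mu] zero_less_one] .
    have "tcost \<gamma> \<le> OT (density lborel (\<lambda>x. ennreal (f n x))) \<mu> + 1" using \<gamma>(2) by simp
    also have "\<dots> \<le> (m + 1) + 1"
      by (intro add_right_mono order.trans[OF fS(5)] add_left_mono) (simp add: ennreal_le_1)
    finally have "tcost \<gamma> \<le> m + 2" by (simp add: add.assoc)
    then have "2 * tcost \<gamma> + 2 * (\<integral>\<^sup>+x. ennreal ((norm x)\<^sup>2) \<partial>\<mu>) \<le> B"
      unfolding B_def by (intro add_right_mono mult_left_mono) simp_all
    with coupling_fst_moment[OF \<gamma>(1)] show ?thesis by (rule order.trans)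
  qed
  have G: "?G \<in> K2"
    by (rule K2_AE_limit[OF _ _ fS(2,3) g lim fS(4) mom B]) measurable
  have "OT ?G \<mu> \<le> m"
    by (rule OT_AE_limit_le[OF mu _ _ fS(2) g(1) lim K2_P2[OF fS(4)] K2_P2[OF G] fS(5)]) measurable
  then have "K2_minimizer \<mu> ?G"
    using G m_le by (auto simp: K2_minimizer_def intro: order.trans)
  then show ?thesis by blast
qed

section \<open>Translating the projection\<close>

text \<open>All costs involved are finite, so \<open>enn2real\<close> preserves and reflects their
  order.\<close>

lemma K2_minimizer_iff_is_arg_min:
  assumes mu: "\<mu> \<in> P2"
  shows "K2_minimizer \<mu> \<rho> \<longleftrightarrow> is_arg_min (\<lambda>\<rho>. (W2 \<rho> \<mu>)\<^sup>2) (\<lambda>\<rho>. \<rho> \<in> K2) \<rho>"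
proof -
  have "OT \<rho> \<mu> \<le> OT \<sigma> \<mu> \<longleftrightarrow> (W2 \<rho> \<mu>)\<^sup>2 \<le> (W2 \<sigma> \<mu>)\<^sup>2" if "\<rho> \<in> K2" "\<sigma> \<in> K2" for \<sigma>
  proof -
    have "OT \<rho> \<mu> < top" "OT \<sigma> \<mu> < top"
      using OT_finite[OF K2_P2[OF that(1)] mu] OT_finite[OF K2_P2[OF that(2)] mu] by simp_all
    then show ?thesis
      unfolding W2_sq by (cases "OT \<rho> \<mu>"; cases "OT \<sigma> \<mu>") (auto simp: ennreal_le_iff)
  qed
  then show ?thesis
    by (auto simp: K2_minimizer_def is_arg_min_def not_less)
qed

text \<open>Existence and uniqueness give the definite description in \<open>proj_K2\<close> its
  meaning.\<close>

lemma K2_minimizer_proj_K2: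
  assumes mu: "\<mu> \<in> P2"
  shows "K2_minimizer \<mu> (proj_K2 \<mu>)"
proof -
  obtain \<rho> where \<rho>: "K2_minimizer \<mu> \<rho>" using K2_minimizer_exists[OF mu] by blast
  have "proj_K2 \<mu> = \<rho>"
    unfolding proj_K2_def K2_minimizer_iff_is_arg_min[OF mu, symmetric]
    using \<rho> K2_minimizer_unique[OF mu _ \<rho>] by (rule the_equality[where P = "K2_minimizer \<mu>"])
  then show ?thesis using \<rho> by simp
qed

lemma K2_minimizer_W2_le:
  assumes "\<mu> \<in> P2" "K2_minimizer \<mu> \<rho>" "\<sigma> \<in> K2"
  shows "(W2 \<rho> \<mu>)\<^sup>2 \<le> (W2 \<sigma> \<mu>)\<^sup>2"
  using assms by (auto simp: K2_minimizer_iff_is_arg_min is_arg_min_def not_less)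

lemma K2_translate:
  assumes "\<rho> \<in> K2"
  shows "translate a \<rho> \<in> K2"
proof -
  have "emeasure (translate a \<rho>) E \<le> emeasure lborel E" if E[measurable]: "E \<in> sets borel" for E
  proof -
    have "emeasure (translate a \<rho>) E = emeasure \<rho> {x. x + a \<in> E}"
      by (rule emeasure_translate[OF P2D(2)[OF K2_P2[OF assms]] E])
    also have "\<dots> \<le> emeasure lborel {x. x + a \<in> E}"
      using assms by (auto simp: K2_iff)
    also have "\<dots> = emeasure lborel E" by (rule emeasure_lborel_shift) simp
    finally show ?thesis .
  qed
  then show ?thesis using P2_translate[OF K2_P2[OF assms]] by (auto simp: K2_iff)
qed

text \<open>Translating the minimizer within \<^const>\<open>K2\<close> so that its barycenter becomes that of \<open>\<mu>\<close>
  would lower the cost.\<close>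

lemma barycenter_K2_minimizer:
  assumes mu: "\<mu> \<in> P2" and min: "K2_minimizer \<mu> \<rho>"
  shows "barycenter \<rho> = barycenter \<mu>"
proof -
  have K: "\<rho> \<in> K2" using min by (simp add: K2_minimizer_def)
  define v where "v = barycenter \<rho> - barycenter \<mu>"
  have "(W2 \<rho> \<mu>)\<^sup>2 \<le> (W2 (translate (- v) \<rho>) (translate 0 \<mu>))\<^sup>2"
    using K2_minimizer_W2_le[OF mu min K2_translate[OF K]] by (simp add: translate_0 P2D[OF mu])
  \<comment> \<open>The shift by \<open>- v\<close> contributes the square of \<open>norm v\<close>,
    the barycenter term minus twice that square.\<close>
  also have "\<dots> = (W2 \<rho> \<mu>)\<^sup>2 - (norm v)\<^sup>2"
    unfolding W2_translate[OF K2_P2[OF K] mu] v_def[symmetric]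
    by (simp add: power2_norm_eq_inner)
  finally show ?thesis by (simp add: v_def)
qed

text \<open>Shifting both measures by one vector preserves the distance, so a competitor for the
  translated problem can be shifted back to one for the original.\<close>

lemma K2_minimizer_translate:
  assumes mu: "\<mu> \<in> P2" and min: "K2_minimizer \<mu> \<rho>"
  shows "K2_minimizer (translate a \<mu>) (translate a \<rho>)"
proof -
  have K: "\<rho> \<in> K2" using min by (simp add: K2_minimizer_def)
  have "(W2 (translate a \<rho>) (translate a \<mu>))\<^sup>2 \<le> (W2 \<sigma> (translate a \<mu>))\<^sup>2" if \<sigma>: "\<sigma> \<in> K2" for \<sigma>
  proof -
    have "(W2 (translate a \<rho>) (translate a \<mu>))\<^sup>2 = (W2 \<rho> \<mu>)\<^sup>2"
      using W2_translate[OF K2_P2[OF K] mu, of a a] by simp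
    also have "\<dots> \<le> (W2 (translate (- a) \<sigma>) \<mu>)\<^sup>2"
      by (rule K2_minimizer_W2_le[OF mu min K2_translate[OF \<sigma>]])
    also have "\<dots> = (W2 (translate a (translate (- a) \<sigma>)) (translate a \<mu>))\<^sup>2"
      using W2_translate[OF P2_translate[OF K2_P2[OF \<sigma>]] mu, of a "- a" a] by simp
    also have "translate a (translate (- a) \<sigma>) = \<sigma>"
      using P2D(2)[OF K2_P2[OF \<sigma>]] by (simp add: translate_translate translate_0)
    finally show ?thesis .
  qed
  then show ?thesis
    using K2_translate[OF K, of a]
    by (auto simp: K2_minimizer_iff_is_arg_min[OF P2_translate[OF mu]] is_arg_min_def not_less)
qed

theorem proposition2p3:
  fixes \<mu> \<nu> \<nu>' :: "(real ^ 'd) measure" and h :: "real ^ 'd"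
  assumes "\<mu> \<in> P2" and "\<nu> \<in> P2"
    and "\<nu>' = distr \<nu> borel (\<lambda>x. x + h)"
  shows "(W2 \<mu> \<nu>)\<^sup>2 - (W2 (proj_K2 \<mu>) (proj_K2 \<nu>))\<^sup>2 =
         (W2 \<mu> \<nu>')\<^sup>2 - (W2 (proj_K2 \<mu>) (proj_K2 \<nu>'))\<^sup>2"
proof -
  have \<nu>': "\<nu>' = translate h \<nu>" using assms(3) by (simp add: translate_def)
  have \<nu>'P: "\<nu>' \<in> P2" unfolding \<nu>' by (rule P2_translate[OF assms(2)])
  note min = K2_minimizer_proj_K2[OF assms(1)] K2_minimizer_proj_K2[OF assms(2)]
  then have P: "proj_K2 \<mu> \<in> P2" "proj_K2 \<nu> \<in> P2"
    by (auto simp: K2_minimizer_def K2_P2)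
  have proj: "proj_K2 \<nu>' = translate h (proj_K2 \<nu>)"
    using K2_minimizer_translate[OF assms(2) min(2), of h] K2_minimizer_proj_K2[OF \<nu>'P]
    by (intro K2_minimizer_unique[OF \<nu>'P]) (simp_all add: \<nu>')
  have "(W2 \<mu> \<nu>')\<^sup>2 = (W2 \<mu> \<nu>)\<^sup>2 + (norm (0 - h))\<^sup>2 + 2 * ((0 - h) \<bullet> (barycenter \<mu> - barycenter \<nu>))"
    using W2_translate[OF assms(1,2), of 0 h] by (simp only: \<nu>' translate_0 P2D(2)[OF assms(1)])
  \<comment> \<open>The barycenters of the projections are replaced by those of \<mu> and \<nu>,
    which makes the correction literally the one for the original pair.\<close>
  moreover have "(W2 (proj_K2 \<mu>) (proj_K2 \<nu>'))\<^sup>2 = (W2 (proj_K2 \<mu>) (proj_K2 \<nu>))\<^sup>2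
      + (norm (0 - h))\<^sup>2 + 2 * ((0 - h) \<bullet> (barycenter \<mu> - barycenter \<nu>))"
    using W2_translate[OF P, of 0 h]
    by (simp only: proj translate_0 P2D(2)[OF P(1)] barycenter_K2_minimizer[OF assms(1) min(1)]
        barycenter_K2_minimizer[OF assms(2) min(2)])
  ultimately show ?thesis by simp
qed

end
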